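(* Let $r_1>1$ and $C>0$ be such that $C\exp(2/r_1)<1/4$ and $Cr_1>1$, define $(r_k)$ recursively by $$r_{k+1}=Cr_k^2\prod_{j=1}^{k}\left(1+\frac{r_k}{r_j}\right)\qquad (k\ge 1),$$ and let $$f(z)=Cz^2\prod_{k=1}^\infty\left(1+\frac{z}{r_k}\right).$$ For large $k$ let $U_k$ be the multiply connected wandering domain of $f$ which contains the annulus $\{z\in\mathbb{C}: r_k^2<|z|<\sqrt{r_{k+1}}\}$. Then $U_k$ is infinitely connected and $\partial U_k$ is not uniformly perfect.
   Context: The Fatou set of an entire function $f$ is the set of points of $\mathbb{C}$ near which the iterates $f^n$ form a normal family; Fatou components are its connected components. A Fatou component $U$ is a wandering domain if the Fatou components containing $f^j(U)$, $j\ge 0$, are pairwise different. In the setting of the claim one has $r_{k+1}\ge 2r_k$ for all $k$, so the product converges. It is known (Baker) that for large $k$ the function $f$ maps $\{r_k^2<|z|<\sqrt{r_{k+1}}\}$ into $\{r_{k+1}^2<|z|<\sqrt{r_{k+2}}\}$, and that $\{r_k^2<|z|<\sqrt{r_{k+1}}\}$ is contained in a multiply connected Fatou component $U_k$ which is a wandering domain. A domain $U\subset\mathbb{C}$ is infinitely connected if $\widehat{\mathbb{C}}\setminus U$ has infinitely many connected components. A closed set $K\subset\mathbb{C}$ is uniformly perfect if there exists $c>0$ such that for all $a\in K$ and $0<r<\operatorname{diam}(K)$ one has $\{z\in\mathbb{C}: cr<|z-a|<r\}\cap K\neq\emptyset$. *)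

theory Defs
  imports "HOL-Analysis.Analysis"
begin

(* Normality with respect to the spherical metric, for a domain D and a family of holomorphic
   functions: a locally uniform spherical limit is then either finite throughout D or the
   constant infinity. *)
definition normal_on :: "complex set \<Rightarrow> (complex \<Rightarrow> complex) set \<Rightarrow> bool" where
  "normal_on D F \<longleftrightarrow>
     (\<forall>g :: nat \<Rightarrow> complex \<Rightarrow> complex. range g \<subseteq> F \<longrightarrow>
       (\<exists>s :: nat \<Rightarrow> nat. strict_mono s \<and>
         ((\<exists>h. \<forall>K. compact K \<and> K \<subseteq> D \<longrightarrow> uniform_limit K (\<lambda>n. g (s n)) h sequentially) \<or>
          (\<forall>K. compact K \<and> K \<subseteq> D \<longrightarrow>
             (\<forall>B. \<forall>\<^sub>F n in sequentially. \<forall>z\<in>K. B < norm (g (s n) z))))))"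

definition fatou_set :: "(complex \<Rightarrow> complex) \<Rightarrow> complex set" where
  "fatou_set f = {z. \<exists>e>0. normal_on (ball z e) (range (\<lambda>n. f ^^ n))}"

definition fatou_components :: "(complex \<Rightarrow> complex) \<Rightarrow> complex set set" where
  "fatou_components f = components (fatou_set f)"

definition wandering_domain :: "(complex \<Rightarrow> complex) \<Rightarrow> complex set \<Rightarrow> bool" where
  "wandering_domain f U \<longleftrightarrow>
     U \<in> fatou_components f \<and>
     (\<exists>V :: nat \<Rightarrow> complex set.
        (\<forall>j. V j \<in> fatou_components f \<and> (f ^^ j) ` U \<subseteq> V j) \<and>
        (\<forall>i j. i \<noteq> j \<longrightarrow> V i \<noteq> V j))"

definition multiply_connected :: "complex set \<Rightarrow> bool" where
  "multiply_connected U \<longleftrightarrow> \<not> simply_connected U"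

(* Its points are Some z for complex z, and None, the point at infinity. *)
definition riemann_sphere :: "complex option topology" where
  "riemann_sphere = Alexandroff_compactification euclidean"

definition infinitely_connected :: "complex set \<Rightarrow> bool" where
  "infinitely_connected U \<longleftrightarrow>
     infinite (connected_components_of
       (subtopology riemann_sphere (topspace riemann_sphere - Some ` U)))"

(* The library's diameter is a real number and is meaningful for bounded sets only;
   an unbounded set has infinite diameter, so that r is then unrestricted. *)
definition uniformly_perfect :: "complex set \<Rightarrow> bool" where
  "uniformly_perfect K \<longleftrightarrow>
     closed K \<and>
     (\<exists>c>0. \<forall>a\<in>K. \<forall>r>0. (bounded K \<longrightarrow> r < diameter K) \<longrightarrow>
        {z. c * r < norm (z - a) \<and> norm (z - a) < r} \<inter> K \<noteq> {})"

end

(* With p k = r (k+1), the annuli L m = {4 p m < |z| < p (m+1) / 2} satisfy f (L m) <= L (m+1), so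
   they escape and lie in the Fatou set. A punctured disc around the zero - p m, of relative inner
   radius 2^-m and relative outer radius of order 1/m, is also mapped into L m, and it is joined to
   L (m-1) inside the preimage of L m.

   In logarithmic coordinates f becomes a map F on the strip |Im| < pi/2 with Re F' >= 2. Its inverse
   branch G contracts by 1/2, and the distortion of all iterates of G on a fixed small disc is
   bounded, because the n-th step contributes a relative error O(2^-n). Pulling the punctured discs
   back by G^n to the level of a given component U yields annuli in U whose moduli tend to infinity
   and whose diameters tend to 0. Each of them surrounds a preimage of the superattracting fixed
   point 0, whose neighbourhood does not escape and hence lies outside U. *)

theory Submission
  imports Defs "HOL-Complex_Analysis.Complex_Analysis"
begin

section \<open>Estimates for the infinite product\<close>

text \<open>The difficulty is to return from a high level to that of \<open>U\<close> without losing
  modulus. All nonzero zeros of \<open>f\<close> are negative, so the pull-back runs along the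
  positive axis: over the right half-plane every term of \<open>F'\<close> has nonnegative real
  part, which gives injectivity and expansion together. The punctured discs, however, lie over the
  negative axis, at imaginary part pi. The first inverse step must therefore start outside the
  strip, and the domain of \<open>G\<close> is widened to imaginary part 3 pi / 2 far to the right,
  where enough zeros have been passed for \<open>F\<close> to expand imaginary parts by 6. Bounded
  distortion costs the ratio of the radii a constant factor only, while that ratio, of order 2^m /
  m, tends to infinity. The diameters shrink because the pulled back centres stay near
  \<open>ln (p (Suc k))\<close> for a fixed \<open>k\<close>, whereas the derivative of the n-th
  iterate of \<open>F\<close> is at least 2^n. The annuli lie in \<open>U\<close> itself, and not in
  another component over the same images, because the set joining a punctured disc to the positive
  axis is pulled back along with it and then contains a chosen positive point of
  \<open>U\<close>.\<close>

locale baker =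
  fixes C :: real and p :: "nat \<Rightarrow> real" and f :: "complex \<Rightarrow> complex"
  assumes p0: "p 0 > 1" and Cpos: "C > 0" and Cexp: "C * exp (2 / p 0) < 1/4"
    and Cp: "C * p 0 > 1"
    and rec: "\<And>k. p (Suc k) = C * (p k)^2 * (\<Prod>j\<le>k. (1 + p k / p j))"
    and feq: "\<And>z. f z = of_real C * z^2 * (\<Prod>k. (1 + z / of_real (p k)))"
begin

text \<open>Once all earlier terms are known to be at most \<open>p k\<close>, each of the
  \<open>Suc k\<close> factors is at least 2, and \<open>C * p k \<ge> C * p 0 > 1\<close> absorbs
  the rest. Monotonicity up to \<open>k\<close> is needed for this, hence the strong
  induction.\<close>

lemma p_ge_p0: "p k \<ge> p 0 \<and> p (Suc k) \<ge> 2 ^ Suc k * p k"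
proof (induction k rule: less_induct)
  case (less k)
  have pos: "p j > 0" if "j < k" for j using less[OF that] p0 by linarith
  have k0: "p k \<ge> p 0"
  proof (cases k)
    case (Suc i)
    then have "2 ^ Suc i * p i \<le> p k" "p i \<ge> p 0" using less[of i] by auto
    moreover have "1 * p i \<le> 2 ^ Suc i * p i" 
      using \<open>p i \<ge> p 0\<close> p0 by (intro mult_right_mono) (auto simp del: power_Suc)
    ultimately show ?thesis by simp
  qed auto
  have mono: "p j \<le> p k" if "j \<le> k" for j
    using that
  proof (induction rule: inc_induct)
    case (step n)
    have "1 * p n \<le> 2 ^ Suc n * p n"
      using pos[of n] step by (intro mult_right_mono) (auto simp del: power_Suc)
    then show ?case using less[of n] step by simp
  qed auto
  have "(2::real) ^ Suc k = (\<Prod>j\<le>k. 2)" by simp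
  also have "\<dots> \<le> (\<Prod>j\<le>k. (1 + p k / p j))"
  proof (rule prod_mono, safe)
    fix j assume "j \<le> k"
    then have "p j > 0" using pos[of j] k0 p0 by (cases "j = k") auto
    then show "2 \<le> 1 + p k / p j" using mono[OF \<open>j \<le> k\<close>] by (simp add: field_simps)
  qed auto
  finally have A: "2 ^ Suc k \<le> (\<Prod>j\<le>k. (1 + p k / p j))" .
  have "C * p k \<ge> 1" using k0 Cp Cpos by (smt (verit) mult_left_mono)
  then have "1 * p k \<le> C * p k * p k" using k0 p0 by (intro mult_right_mono) auto
  then have "p k \<le> C * (p k)^2" by (simp add: power2_eq_square mult_ac)
  then have "p k * 2 ^ Suc k \<le> C * (p k)^2 * (\<Prod>j\<le>k. (1 + p k / p j))"
    using A k0 p0 Cpos by (intro mult_mono) auto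
  then show ?case using k0 unfolding rec[of k] by (simp add: mult.commute)
qed

lemma p_pos [simp]: "p k > 0" and p_ge_0 [simp]: "p k \<ge> 0" 
  and p_ne_0 [simp]: "p k \<noteq> 0"
  using p_ge_p0[of k] p0 by auto

lemma p_Suc_ge: "p (Suc k) \<ge> 2 ^ Suc k * p k"
  using p_ge_p0 by blast

lemma p_Suc_ge_2: "p (Suc k) \<ge> 2 * p k"
proof -
  have "2 * p k \<le> 2 ^ Suc k * p k" by (intro mult_right_mono) auto
  then show ?thesis using p_Suc_ge[of k] by linarith
qed

lemma p_add_ge: "p (m + i) \<ge> 2 ^ i * p m"
proof (induction i)
  case (Suc i)
  show ?case using p_Suc_ge_2[of "m + i"] Suc by simp
qed auto

lemma p_mono: "j \<le> k \<Longrightarrow> p j \<le> p k"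
  using lift_Suc_mono_le[of p] p_Suc_ge_2 p_pos by (smt (verit))

lemma p_ge_two_pow: "p k \<ge> 2 ^ k"
proof -
  have "2 ^ k * 1 \<le> 2 ^ k * p 0" using p0 by (intro mult_left_mono) auto
  also have "\<dots> \<le> p k" using p_add_ge[of k 0] by simp
  finally show ?thesis by simp
qed

text \<open>The factor with j = m equals 2. It is split off because near \<open>- p m\<close> the
  corresponding factor of \<open>f\<close> is small and has to be estimated by itself.\<close>

lemma p_Suc_eq: "p (Suc m) = 2 * C * (p m)^2 * (\<Prod>j<m. (1 + p m / p j))"
proof -
  have "{..m} = insert m {..<m}" by auto
  then show ?thesis unfolding rec[of m] by simp
qed

lemma inverse_p_add_le: "1 / p (m + i) \<le> (1/2) ^ i / p m"
proof -
  have "1 / p (m + i) \<le> 1 / (2 ^ i * p m)"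
    using p_add_ge[of i m] by (intro divide_left_mono) (auto simp: p_add_ge)
  then show ?thesis by (simp add: power_divide)
qed

lemma summable_inverse_p: "summable (\<lambda>k. 1 / p k)"
proof (rule summable_comparison_test')
  show "summable (\<lambda>i. (1/2) ^ i / p 0)" by (intro summable_divide summable_geometric) auto
qed (use inverse_p_add_le[of 0] in \<open>auto simp: abs_of_pos\<close>)

lemma sum_inverse_p_le: "(\<Sum>k\<in>{m..<n}. 1 / p k) \<le> 2 / p m"
proof (cases "m \<le> n")
  case True
  have "(\<Sum>k\<in>{m..<n}. 1 / p k) = (\<Sum>i<n-m. 1 / p (m + i))"
    using True by (subst sum.reindex_bij_witness[of _ "\<lambda>i. m + i" "\<lambda>k. k - m"]) auto
  also have "\<dots> \<le> (\<Sum>i<n-m. (1/2) ^ i / p m)" by (intro sum_mono inverse_p_add_le)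
  also have "\<dots> = (\<Sum>i<n-m. (1/2) ^ i) / p m" by (simp add: sum_divide_distrib)
  also have "\<dots> \<le> 2 / p m"
  proof (rule divide_right_mono)
    show "(\<Sum>i<n-m. (1/2::real) ^ i) \<le> 2" by (subst sum_gp_strict) auto
  qed auto
  finally show ?thesis .
qed auto

section \<open>Two-sided bounds for \<open>f\<close> by truncated products\<close>

lemma f_partial: "(\<lambda>n. of_real C * z^2 * (\<Prod>k<n. 1 + z / of_real (p k))) \<longlonglongrightarrow> f z"
proof -
  have "summable (\<lambda>k. norm z * (1 / p k))" using summable_inverse_p by (rule summable_mult)
  then have "abs_convergent_prod (\<lambda>k. 1 + z / of_real (p k))"
    by (intro summable_imp_abs_convergent_prod) (simp add: norm_divide)
  then have "convergent_prod (\<lambda>k. 1 + z / of_real (p k))"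
    by (rule abs_convergent_prod_imp_convergent_prod)
  from convergent_prod_LIMSEQ[OF this]
  have "(\<lambda>n. \<Prod>k<n. 1 + z / of_real (p k)) \<longlonglongrightarrow> (\<Prod>k. 1 + z / of_real (p k))"
    unfolding lessThan_Suc_atMost[symmetric] by (subst (asm) filterlim_sequentially_Suc)
  then show ?thesis unfolding feq by (intro tendsto_intros)
qed

text \<open>The reciprocals of \<open>p k\<close> with \<open>k \<ge> m\<close> sum to at most
  \<open>2 / p m\<close>. The tail of the product is therefore controlled by the exponential from
  above and by the Weierstrass product inequality from below; \<open>2 * norm z \<le> p m\<close>
  keeps the terms of the latter in [0,1].\<close>

lemma f_bounds:
  fixes z :: complex and m :: nat
  defines "P \<equiv> C * (norm z)^2 * (\<Prod>k<m. norm (1 + z / of_real (p k)))"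
  shows "norm (f z) \<le> P * exp (2 * norm z / p m)"
    and "2 * norm z \<le> p m \<Longrightarrow> norm (f z) \<ge> P * (1 - 2 * norm z / p m)"
proof -
  have P0: "P \<ge> 0" unfolding P_def using Cpos by (intro mult_nonneg_nonneg prod_nonneg) auto
  define Q where "Q n = of_real C * z^2 * (\<Prod>k<n. 1 + z / of_real (p k))" for n
  have lim: "(\<lambda>n. norm (Q n)) \<longlonglongrightarrow> norm (f z)"
    unfolding Q_def by (intro tendsto_norm f_partial)
  have Q: "norm (Q n) = P * (\<Prod>k\<in>{m..<n}. norm (1 + z / of_real (p k)))" if "n \<ge> m" for n
  proof -
    have "{..<n} = {..<m} \<union> {m..<n}" using that by auto
    then have "(\<Prod>k<n. norm (1 + z / of_real (p k))) = 
       (\<Prod>k<m. norm (1 + z / of_real (p k))) * (\<Prod>k\<in>{m..<n}. norm (1 + z / of_real (p k)))"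
      by (metis prod.union_disjoint finite_lessThan finite_atLeastLessThan ivl_disj_int_one(2))
    then show ?thesis unfolding Q_def P_def 
      using Cpos by (simp add: norm_mult norm_power prod_norm mult_ac)
  qed
  have S: "(\<Sum>k\<in>{m..<n}. norm z / p k) \<le> 2 * norm z / p m" for n
    using mult_left_mono[OF sum_inverse_p_le[of m n], of "norm z"]
    by (simp add: sum_distrib_left mult.commute)
  show "norm (f z) \<le> P * exp (2 * norm z / p m)"
  proof (rule tendsto_upperbound[OF lim])
    show "\<forall>\<^sub>F n in sequentially. norm (Q n) \<le> P * exp (2 * norm z / p m)"
      using eventually_ge_at_top[of m]
    proof eventually_elim
      case (elim n)
      have "(\<Prod>k\<in>{m..<n}. norm (1 + z / of_real (p k))) \<le> (\<Prod>k\<in>{m..<n}. exp (norm z / p k))"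
      proof (rule prod_mono, safe)
        fix k
        have "norm (1 + z / of_real (p k)) \<le> 1 + norm z / p k"
          by (rule order_trans[OF norm_triangle_ineq]) (simp add: norm_divide)
        also have "\<dots> \<le> exp (norm z / p k)" by (rule exp_ge_add_one_self)
        finally show "norm (1 + z / of_real (p k)) \<le> exp (norm z / p k)" .
      qed auto
      also have "\<dots> = exp (\<Sum>k\<in>{m..<n}. norm z / p k)" by (simp add: exp_sum)
      also have "\<dots> \<le> exp (2 * norm z / p m)" using S by simp
      finally show ?case unfolding Q[OF elim] using P0 by (rule mult_left_mono)
    qed
  qed simp
  show "norm (f z) \<ge> P * (1 - 2 * norm z / p m)" if le: "2 * norm z \<le> p m"
  proof (rule tendsto_lowerbound[OF lim])
    show "\<forall>\<^sub>F n in sequentially. norm (Q n) \<ge> P * (1 - 2 * norm z / p m)"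
      using eventually_ge_at_top[of m]
    proof eventually_elim
      case (elim n)
      have le1: "norm z / p k \<le> 1" if "k \<ge> m" for k
        using p_mono[OF that] le by (simp add: field_simps) (smt (verit) norm_ge_zero)
      have "1 - 2 * norm z / p m \<le> 1 - (\<Sum>k\<in>{m..<n}. norm z / p k)" using S[of n] by linarith
      also have "\<dots> \<le> (\<Prod>k\<in>{m..<n}. 1 - norm z / p k)"
        using le1 by (intro Weierstrass_prod_ineq) auto
      also have "\<dots> \<le> (\<Prod>k\<in>{m..<n}. norm (1 + z / of_real (p k)))"
      proof (rule prod_mono, safe)
        fix k assume "k \<in> {m..<n}"
        then show "0 \<le> 1 - norm z / p k" using le1[of k] by auto
        show "1 - norm z / p k \<le> norm (1 + z / of_real (p k))"
          using norm_diff_ineq[of 1 "z / of_real (p k)"] by (simp add: norm_divide)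
      qed
      finally show ?case unfolding Q[OF elim] using P0 by (intro mult_left_mono)
    qed
  qed simp
qed

text \<open>All zeros lie on the closed negative axis, so each factor is largest in modulus at the
  positive point of its circle.\<close>

lemma norm_f_le_f_norm: "norm (f z) \<le> norm (f (of_real (norm z)))"
proof (rule tendsto_le[OF _ tendsto_norm[OF f_partial] tendsto_norm[OF f_partial]])
  show "\<forall>\<^sub>F n in sequentially. norm (of_real C * z^2 * (\<Prod>k<n. 1 + z / of_real (p k)))
     \<le> norm (of_real C * (of_real (norm z))^2 * (\<Prod>k<n. 1 + of_real (norm z) / complex_of_real (p k)))"
  proof (intro always_eventually allI)
    fix n
    have "(\<Prod>k<n. norm (1 + z / of_real (p k)))
      \<le> (\<Prod>k<n. norm (1 + of_real (norm z) / complex_of_real (p k)))"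
    proof (rule prod_mono, safe)
      fix k
      have "norm (1 + z / of_real (p k)) \<le> 1 + norm z / p k"
        by (rule order_trans[OF norm_triangle_ineq]) (simp add: norm_divide)
      also have "\<dots> = norm (of_real (1 + norm z / p k) :: complex)"
        by (subst norm_of_real) (simp add: add_nonneg_nonneg)
      finally show "norm (1 + z / of_real (p k)) \<le> norm (1 + of_real (norm z) / complex_of_real (p k))"
        by simp
    qed auto
    then show "norm (of_real C * z^2 * (\<Prod>k<n. 1 + z / of_real (p k)))
     \<le> norm (of_real C * (of_real (norm z))^2 * (\<Prod>k<n. 1 + of_real (norm z) / complex_of_real (p k)))"
      unfolding norm_mult norm_power prod_norm[symmetric] using Cpos by (intro mult_mono) (auto intro!: prod_nonneg)
  qed
qed auto

lemma continuous_on_f: "continuous_on A f"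
proof -
  have ball: "continuous_on (cball 0 B) f" for B :: real
  proof -
    have "uniformly_convergent_on (cball 0 B) (\<lambda>N x. \<Prod>n<N. 1 + x / complex_of_real (p n))"
    proof (rule uniformly_convergent_on_prod)
      show "uniformly_convergent_on (cball 0 B) (\<lambda>N x. \<Sum>n<N. norm (x / complex_of_real (p n)))"
      proof (rule Weierstrass_m_test')
        show "summable (\<lambda>k. B * (1 / p k))" using summable_inverse_p by (rule summable_mult)
      qed (auto simp: norm_divide intro!: divide_right_mono)
    qed (auto intro!: continuous_intros)
    then obtain g where g: "uniform_limit (cball 0 B) (\<lambda>N x. \<Prod>n<N. 1 + x / complex_of_real (p n)) g sequentially"
      by (auto simp: uniformly_convergent_on_def)
    have contg: "continuous_on (cball 0 B) g"
      by (rule uniform_limit_theorem[OF _ g]) (auto intro!: always_eventually continuous_intros)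
    have "f x = of_real C * x^2 * g x" if "x \<in> cball 0 B" for x
      by (rule LIMSEQ_unique[OF f_partial]) (intro tendsto_intros tendsto_uniform_limitI[OF g that])
    moreover have "continuous_on (cball 0 B) (\<lambda>x. of_real C * x^2 * g x)"
      by (intro continuous_intros contg)
    ultimately show ?thesis by (metis (no_types, lifting) continuous_on_cong)
  qed
  have "isCont f x" for x
    using continuous_on_interior[OF ball[of "norm x + 1"], of x] by simp
  then show ?thesis by (simp add: continuous_at_imp_continuous_on)
qed

lemma continuous_on_f_iter: "continuous_on A (f ^^ n)"
proof (induction n)
  case (Suc n)
  then show ?case
    using continuous_on_compose[OF Suc continuous_on_f] by (simp add: o_def)
qed (simp add: continuous_on_id')

text \<open>This is the use of \<open>C * exp (2 / p 0) < 1/4\<close>: an orbit that meets the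
  closed unit disc stays there and cannot escape.\<close>

lemma basin: 
  assumes "norm z \<le> 1"
  shows "norm (f z) \<le> 1"
proof -
  have "norm (f z) \<le> C * (norm z)^2 * exp (2 * norm z / p 0)"
    using f_bounds(1)[of z 0] by simp
  also have "\<dots> \<le> C * 1 * exp (2 * 1 / p 0)"
    using assms Cpos by (intro mult_mono) (auto intro!: divide_right_mono power_le_one)
  finally show ?thesis using Cexp by simp
qed

text \<open>The margins are constant factors, not powers as in the annulus of the claim. Only so
  does \<open>L (m - 1)\<close> come close enough to the circle through \<open>- p m\<close> to be
  reached from a neighbourhood of that zero of relative size 3/5.\<close>

definition L :: "nat \<Rightarrow> complex set" where
  "L m = {z. 4 * p m < norm z \<and> norm z < p (Suc m) / 2}"

text \<open>Upper bound: the square contributes 1/4 and the tail less than 2. Lower bound: the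
  square contributes 16, and the factor of index \<open>Suc m\<close> and the tail lose at most 1/2
  each, which leaves exactly 4; the gain of 3/2 in each earlier factor makes the inequality
  strict.\<close>

lemma f_L:
  assumes z: "z \<in> L m"
  shows "f z \<in> L (Suc m)"
proof -
  have z1: "4 * p m < norm z" and z2: "norm z < p (Suc m) / 2" using z by (auto simp: L_def)
  have e: "{..<Suc (Suc m)} = insert (Suc m) {..m}" by auto
  have q: "4 * p (Suc m) \<le> p (Suc (Suc m))"
  proof -
    have "(4::real) \<le> 2 ^ Suc (Suc m)" by simp
    then have "4 * p (Suc m) \<le> 2 ^ Suc (Suc m) * p (Suc m)" by (intro mult_right_mono) auto
    then show ?thesis using p_Suc_ge[of "Suc m"] by linarith
  qed
  have zq: "2 * norm z / p (Suc (Suc m)) \<le> 1/4"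
    using z2 q p_pos[of "Suc (Suc m)"] norm_ge_zero[of z] unfolding pos_divide_le_eq[OF p_pos] by linarith
  have "norm (f z) \<le> C * (norm z)^2 * (\<Prod>k<Suc (Suc m). norm (1 + z / of_real (p k))) * exp (2 * norm z / p (Suc (Suc m)))"
    by (rule f_bounds)
  also have "\<dots> \<le> C * (p (Suc m) / 2)^2 * (\<Prod>k<Suc (Suc m). 1 + p (Suc m) / p k) * exp (1/4)"
  proof (intro mult_mono power_mono prod_mono)
    fix k
    have "norm (1 + z / of_real (p k)) \<le> 1 + norm z / p k"
      by (rule order_trans[OF norm_triangle_ineq]) (simp add: norm_divide)
    also have "\<dots> \<le> 1 + p (Suc m) / p k"
      using z2 p_pos[of "Suc m"] by (intro add_left_mono divide_right_mono) (linarith, simp)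
    finally show "0 \<le> norm (1 + z / of_real (p k)) \<and> norm (1 + z / of_real (p k)) \<le> 1 + p (Suc m) / p k" by simp
  qed (use zq z2 Cpos in \<open>auto intro!: mult_nonneg_nonneg prod_nonneg add_nonneg_nonneg\<close>)
  also have "\<dots> = p (Suc (Suc m)) / 4 * exp (1/4)"
    unfolding rec[of "Suc m"] lessThan_Suc_atMost by (simp add: power2_eq_square)
  also have "\<dots> < p (Suc (Suc m)) / 4 * 2"
    using exp_bound[of "1/4"] by (intro mult_strict_left_mono) (auto simp: power2_eq_square)
  finally have 1: "norm (f z) < p (Suc (Suc m)) / 2" by simp

  have zq': "1/2 \<le> 1 - 2 * norm z / p (Suc (Suc m))" using zq by linarith
  have half: "norm (1 + z / of_real (p (Suc m))) \<ge> 1/2"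
  proof -
    have "norm z / p (Suc m) \<le> 1/2" using z2 unfolding pos_divide_le_eq[OF p_pos] by linarith
    moreover have "1 - norm z / p (Suc m) \<le> norm (1 + z / of_real (p (Suc m)))"
      using norm_diff_ineq[of 1 "z / of_real (p (Suc m))"] by (simp add: norm_divide)
    ultimately show ?thesis by linarith
  qed
  have "(3/2) ^ Suc m * (\<Prod>k\<le>m. 1 + p m / p k) = (\<Prod>k\<le>m. 3/2 * (1 + p m / p k))"
    by (subst prod.distrib) simp
  also have "\<dots> \<le> (\<Prod>k\<le>m. norm (1 + z / of_real (p k)))"
  proof (rule prod_mono, safe)
    fix k assume "k \<le> m"
    show "0 \<le> 3/2 * (1 + p m / p k)" by (simp add: add_nonneg_nonneg)
    have x: "p m / p k \<ge> 1" using p_mono[OF \<open>k \<le> m\<close>] by simp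
    have "4 * (p m / p k) \<le> norm z / p k" using divide_right_mono[of "4 * p m" "norm z" "p k"] z1 by simp
    moreover have "norm z / p k - 1 \<le> norm (1 + z / of_real (p k))"
      using norm_diff_ineq[of "z / of_real (p k)" 1] by (simp add: norm_divide add.commute)
    ultimately show "3/2 * (1 + p m / p k) \<le> norm (1 + z / of_real (p k))"
      using x unfolding distrib_left by linarith
  qed
  finally have pr: "(3/2) ^ Suc m * (\<Prod>k\<le>m. 1 + p m / p k) \<le> (\<Prod>k\<le>m. norm (1 + z / of_real (p k)))" .
  have ge0: "(\<Prod>k\<le>m. 1 + p m / p k) \<ge> 0" by (intro prod_nonneg) (auto simp: add_nonneg_nonneg)
  have "4 * p (Suc m) < 4 * (3/2) ^ Suc m * p (Suc m)"
    using one_less_power[of "3/2::real" "Suc m"] by (simp del: power_Suc)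
  also have "\<dots> = C * (4 * p m)^2 * ((1/2) * ((3/2) ^ Suc m * (\<Prod>k\<le>m. 1 + p m / p k))) * (1/2)"
    unfolding rec[of m] by (simp add: power2_eq_square del: power_Suc)
  also have "\<dots> \<le> C * (norm z)^2 * (norm (1 + z / of_real (p (Suc m))) * (\<Prod>k\<le>m. norm (1 + z / of_real (p k))))
       * (1 - 2 * norm z / p (Suc (Suc m)))"
  proof (intro mult_mono power_mono)
    show "1/2 \<le> 1 - 2 * norm z / p (Suc (Suc m))" by (rule zq')
  qed (use z1 half pr Cpos ge0 in \<open>auto intro!: mult_nonneg_nonneg prod_nonneg simp del: power_Suc\<close>)
  also have "\<dots> = C * (norm z)^2 * (\<Prod>k<Suc (Suc m). norm (1 + z / of_real (p k))) * (1 - 2 * norm z / p (Suc (Suc m)))"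
    unfolding e by simp
  also have "\<dots> \<le> norm (f z)" 
    using z2 q p_pos[of "Suc m"] by (intro f_bounds(2)) linarith
  finally show ?thesis using 1 by (simp add: L_def)
qed

lemma f_iter_L: "z \<in> L m \<Longrightarrow> (f ^^ n) z \<in> L (m + n)"
  by (induction n) (auto simp: f_L)

text \<open>Each of the m ratios \<open>p m / p j\<close> is at least 2^m. This superexponential
  gain outweighs the losses of order 10^m that occur in discs around a zero.\<close>

lemma p_Suc_ge_square: "p (Suc m) \<ge> 2 ^ (m * m) * p m"
proof -
  have ge: "2 ^ m \<le> p m / p j" if j: "j < m" for j
  proof -
    obtain i where i: "m = Suc i" using j by (cases m) auto
    have "2 ^ m * p j \<le> 2 ^ m * p i" using p_mono[of j i] j i by (intro mult_left_mono) auto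
    also have "\<dots> \<le> p m" using p_Suc_ge[of i] i by simp
    finally show ?thesis by (simp add: field_simps)
  qed
  have "(2::real) ^ (m * m) = (\<Prod>j<m. 2 ^ m)" by (simp add: power_mult)
  also have "\<dots> \<le> (\<Prod>j<m. 1 + p m / p j)"
    by (rule prod_mono) (use ge in \<open>auto intro: order_trans[OF ge]\<close>)
  finally have A: "2 ^ (m * m) \<le> (\<Prod>j<m. 1 + p m / p j)" .
  have "C * p m \<ge> 1" using p_ge_p0[of m] Cp Cpos by (smt (verit) mult_left_mono)
  then have "p m \<le> C * p m * p m" using mult_right_mono[of 1 "C * p m" "p m"] by simp
  moreover have "0 \<le> C * p m * p m" using Cpos by simp
  ultimately have "p m \<le> 2 * C * (p m)^2" by (simp add: power2_eq_square)
  then have "p m * 2 ^ (m*m) \<le> 2 * C * (p m)^2 * (\<Prod>j<m. 1 + p m / p j)"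
    using A Cpos by (intro mult_mono) auto
  then show ?thesis unfolding p_Suc_eq[of m] by (simp add: mult.commute)
qed

text \<open>The constants \<open>2/5\<close> and \<open>3/5\<close> are chosen so that the region reaches from the simple zero
  \<open>- p m\<close> of \<open>f\<close> down into \<open>L (m - 1)\<close>.\<close>

lemma f_near_zero:
  assumes m: "m \<ge> 10"
    and z1: "norm z \<ge> 2/5 * p m" and z2: "norm z \<le> (1 + 1 / (8 * (real m + 2))) * p m"
    and u1: "norm (1 + z / of_real (p m)) \<ge> 1 / 2 ^ m" and u2: "norm (1 + z / of_real (p m)) \<le> 3/5"
  shows "f z \<in> L m"
proof -
  \<comment> \<open>The excess \<open>1 + d\<close> occurs m times in the product and twice in the
    square; this \<open>d\<close> keeps its power \<open>m + 2\<close> below exp(1/8).\<close>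
  define d where "d = 1 / (8 * (real m + 2))"
  have d: "d \<ge> 0" "d \<le> 1" "d * (real m + 2) = 1/8"
    using m by (auto simp: d_def field_simps)
  have z2': "norm z \<le> (1 + d) * p m" using z2 by (simp add: d_def add.commute)
  have big: "4096 * p m \<le> p (Suc m)"
  proof -
    have "(2::real) ^ 12 \<le> 2 ^ (m * m)" using m mult_mono[of 10 m 10 m] by (intro power_increasing) auto
    then have "2 ^ 12 * p m \<le> 2 ^ (m * m) * p m" by (intro mult_right_mono) auto
    also have "\<dots> \<le> p (Suc m)" by (rule p_Suc_ge_square)
    finally show ?thesis by simp
  qed
  have "(1 + d) * p m \<le> 2 * p m" using d by (intro mult_right_mono) auto
  then have zle: "norm z \<le> 2 * p m" using z2' by linarith
  have zq: "2 * norm z / p (Suc m) \<le> 1/8" using zle big p_pos[of m] unfolding pos_divide_le_eq[OF p_pos] by linarith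
  have "(1 + d) ^ (m + 2) \<le> exp d ^ (m + 2)" using d by (intro power_mono) auto
  also have "\<dots> = exp (real (m + 2) * d)" by (rule exp_of_nat_mult[symmetric])
  also have "\<dots> = exp (1/8)" using d(3) by (simp add: mult.commute add.commute)
  finally have ed: "(1 + d) ^ (m + 2) \<le> exp (1/8)" .
  have ed2: "(1 + d) ^ (m + 2) * exp (1/8) \<le> 4/3"
  proof -
    have "(1 + d) ^ (m + 2) * exp (1/8) \<le> exp (1/8) * exp (1/8)" using ed by simp
    also have "\<dots> = exp (1/4)" by (simp add: exp_add[symmetric])
    also have "\<dots> \<le> 4/3" using exp_bound[of "1/4"] by (simp add: power2_eq_square)
    finally show ?thesis .
  qed
  have "norm (f z) \<le> C * (norm z)^2 * (\<Prod>k<Suc m. norm (1 + z / of_real (p k))) * exp (2 * norm z / p (Suc m))"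
    by (rule f_bounds)
  also have "\<dots> = C * (norm z)^2 * ((\<Prod>k<m. norm (1 + z / of_real (p k))) * norm (1 + z / of_real (p m))) * exp (2 * norm z / p (Suc m))"
    by simp
  also have "\<dots> \<le> C * ((1 + d) * p m)^2 * ((\<Prod>k<m. (1 + d) * (1 + p m / p k)) * (3/5)) * exp (1/8)"
  proof (intro mult_mono power_mono prod_mono)
    fix k
    have "norm (1 + z / of_real (p k)) \<le> 1 + norm z / p k"
      by (rule order_trans[OF norm_triangle_ineq]) (simp add: norm_divide)
    also have "\<dots> \<le> 1 + (1 + d) * p m / p k" using z2' by (auto intro!: divide_right_mono)
    also have "\<dots> \<le> (1 + d) * (1 + p m / p k)" using d by (simp add: algebra_simps)
    finally show "0 \<le> norm (1 + z / of_real (p k)) \<and> norm (1 + z / of_real (p k)) \<le> (1 + d) * (1 + p m / p k)" by simp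
  qed (use zq z2' u2 d Cpos in \<open>auto intro!: mult_nonneg_nonneg prod_nonneg add_nonneg_nonneg\<close>)
  also have "\<dots> = 3/10 * p (Suc m) * ((1 + d) ^ (m + 2) * exp (1/8))"
    unfolding p_Suc_eq[of m] prod.distrib by (simp add: power2_eq_square power_add)
  also have "\<dots> \<le> 3/10 * p (Suc m) * (4/3)" using ed2 by (intro mult_left_mono) auto
  also have "\<dots> < p (Suc m) / 2" by simp
  finally have 1: "norm (f z) < p (Suc m) / 2" .

  have "(1/5) ^ m * (\<Prod>k<m. 1 + p m / p k) = (\<Prod>k<m. 1/5 * (1 + p m / p k))"
    by (subst prod.distrib) simp
  also have "\<dots> \<le> (\<Prod>k<m. norm (1 + z / of_real (p k)))"
  proof (rule prod_mono, safe)
    fix k assume k: "k < m"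
    show "0 \<le> 1/5 * (1 + p m / p k)" by (simp add: add_nonneg_nonneg)
    \<comment> \<open>The inequality 2/5 x - 1 >= 1/5 (1 + x) holds exactly from x = 6 on.\<close>
    have "p m / p k \<ge> 6"
    proof -
      obtain i where i: "m = Suc i" using m by (cases m) auto
      have "(2::real) ^ 3 \<le> 2 ^ Suc i" using m i by (intro power_increasing) auto
      then have "2 ^ 3 * p k \<le> 2 ^ Suc i * p i" using p_mono[of k i] k i by (intro mult_mono) auto
      also have "\<dots> \<le> p m" using p_Suc_ge[of i] i by simp
      finally have "8 * p k \<le> p m" by simp
      then have "6 * p k \<le> p m" using p_pos[of k] by linarith
      then show ?thesis by (simp add: field_simps)
    qed
    moreover have "2/5 * (p m / p k) \<le> norm z / p k" 
      using divide_right_mono[OF z1, of "p k"] by simp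
    moreover have "norm z / p k - 1 \<le> norm (1 + z / of_real (p k))"
      using norm_diff_ineq[of "z / of_real (p k)" 1] by (simp add: norm_divide add.commute)
    ultimately show "1/5 * (1 + p m / p k) \<le> norm (1 + z / of_real (p k))"
      unfolding distrib_left by linarith
  qed
  finally have pr: "(1/5) ^ m * (\<Prod>k<m. 1 + p m / p k) \<le> (\<Prod>k<m. norm (1 + z / of_real (p k)))" .
  have ge0: "(\<Prod>k<m. 1 + p m / p k) \<ge> 0" by (intro prod_nonneg) (auto simp: add_nonneg_nonneg)
  \<comment> \<open>The factors (1/5)^m and 1 / 2^m lose only an exponential in m against the gain
    2^(m*m); \<open>m \<ge> 10\<close> gives 7 + 4 m <= m * m.\<close>
  have "4 * p m < 1/25 * (1/5) ^ m * (1 / 2 ^ m) * p (Suc m)"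
  proof -
    have "(100::real) * 5 ^ m * 2 ^ m < 2 ^ 7 * 8 ^ m * 2 ^ m"
      by (intro mult_strict_right_mono mult_less_le_imp_less power_mono) auto
    also have "\<dots> = 2 ^ (7 + 4 * m)" 
      by (simp add: power_add power_mult power_mult_distrib[symmetric])
    also have "\<dots> \<le> 2 ^ (m * m)"
    proof (rule power_increasing)
      show "7 + 4 * m \<le> m * m" using m mult_le_mono1[of 10 m m] by linarith
    qed simp
    finally have "100 * 5 ^ m * 2 ^ m * p m < 2 ^ (m * m) * p m" by (intro mult_strict_right_mono) auto
    also have "\<dots> \<le> p (Suc m)" by (rule p_Suc_ge_square)
    finally show ?thesis by (simp add: field_simps)
  qed
  also have "\<dots> = C * (2/5 * p m)^2 * (((1/5) ^ m * (\<Prod>k<m. 1 + p m / p k)) * (1 / 2 ^ m)) * (1/2)"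
    unfolding p_Suc_eq[of m] by (simp add: power2_eq_square)
  also have "\<dots> \<le> C * (norm z)^2 * ((\<Prod>k<m. norm (1 + z / of_real (p k))) * norm (1 + z / of_real (p m)))
       * (1 - 2 * norm z / p (Suc m))"
  proof (intro mult_mono power_mono)
    show "1/2 \<le> 1 - 2 * norm z / p (Suc m)" using zq by linarith
  qed (use z1 u1 pr Cpos ge0 in \<open>auto intro!: mult_nonneg_nonneg prod_nonneg\<close>)
  also have "\<dots> = C * (norm z)^2 * (\<Prod>k<Suc m. norm (1 + z / of_real (p k))) * (1 - 2 * norm z / p (Suc m))"
    by simp
  also have "\<dots> \<le> norm (f z)" 
    using zle big p_pos[of "m"] by (intro f_bounds(2)) linarith
  finally show ?thesis using 1 by (simp add: L_def)
qed

end

section \<open>Logarithmic coordinates\<close>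

text \<open>The Noshiro-Warschawski argument: along the segment, the derivative of the real part of
  \<open>h * cnj (b - a)\<close> is \<open>(norm (b - a))^2 * Re h'\<close>. Keeping the real part
  instead of passing to norms also yields bounds for imaginary parts, from vertical
  segments.\<close>

lemma Re_has_field_derivative_lower:
  fixes h h' :: "complex \<Rightarrow> complex"
  assumes Q: "convex Q" "a \<in> Q" "b \<in> Q"
    and der: "\<And>z. z \<in> Q \<Longrightarrow> (h has_field_derivative h' z) (at z)"
    and lower: "\<And>z. z \<in> Q \<Longrightarrow> \<kappa> \<le> Re (h' z)"
  shows "\<kappa> * (norm (b - a))^2 \<le> Re ((h b - h a) * cnj (b - a))"
proof -
  define \<psi> where "\<psi> t = Re (h (a + of_real t * (b - a)) * cnj (b - a)) - \<kappa> * (norm (b - a))^2 * t" for t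
  have "\<psi> 0 \<le> \<psi> 1"
  proof (rule DERIV_nonneg_imp_nondecreasing[of 0 1 \<psi>])
    fix t :: real assume t: "0 \<le> t" "t \<le> 1"
    define w where "w = a + of_real t * (b - a)"
    have "w = (1 - t) *\<^sub>R a + t *\<^sub>R b" by (simp add: w_def scaleR_conv_of_real algebra_simps)
    then have w: "w \<in> Q" using t Q by (auto simp: convex_alt)
    have 1: "((\<lambda>t. a + of_real t * (b - a)) has_vector_derivative (b - a)) (at t)"
      by (auto intro!: derivative_eq_intros has_vector_derivative_real_field)
    have "(h \<circ> (\<lambda>t. a + of_real t * (b - a)) has_vector_derivative (b - a) * h' w) (at t)"
      by (rule field_vector_diff_chain_at[OF 1]) (use der[OF w] in \<open>simp add: w_def\<close>)
    then have "((\<lambda>t. h (a + of_real t * (b - a)) * cnj (b - a)) has_vector_derivative ((b - a) * h' w) * cnj (b - a)) (at t)"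
      by (intro has_vector_derivative_mult_left) (simp add: o_def)
    then have "((\<lambda>t. Re (h (a + of_real t * (b - a)) * cnj (b - a))) has_vector_derivative Re (((b - a) * h' w) * cnj (b - a))) (at t)"
      by (rule bounded_linear.has_vector_derivative[OF bounded_linear_Re])
    then have "(\<psi> has_real_derivative Re (((b - a) * h' w) * cnj (b - a)) - \<kappa> * (norm (b - a))^2) (at t)"
      unfolding \<psi>_def has_real_derivative_iff_has_vector_derivative[symmetric]
      by (rule DERIV_diff[OF _ DERIV_cmult_Id])
    moreover have "((b - a) * h' w) * cnj (b - a) = of_real ((norm (b - a))^2) * h' w"
      by (simp only: complex_norm_square mult_ac)
    then have "Re (((b - a) * h' w) * cnj (b - a)) = (norm (b - a))^2 * Re (h' w)"
      by (metis Re_complex_of_real Im_complex_of_real times_complex.sel(1) mult_zero_left diff_zero)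
    moreover have "\<kappa> * (norm (b - a))^2 \<le> (norm (b - a))^2 * Re (h' w)"
      using mult_left_mono[OF lower[OF w], of "(norm (b - a))^2"] by (simp add: mult.commute)
    ultimately show "\<exists>y. (\<psi> has_real_derivative y) (at t) \<and> 0 \<le> y" by force
  qed simp
  then show ?thesis by (simp add: \<psi>_def algebra_simps)
qed

lemma norm_exp_minus_one_bounds:
  fixes w :: complex
  assumes "norm w \<le> 1/4"
  shows "norm (exp w - 1) \<le> 2 * norm w" and "norm w / 2 \<le> norm (exp w - 1)"
proof -
  have "norm (exp w - (\<Sum>i\<le>1. w ^ i / fact i)) \<le> exp (norm w) * (norm w ^ Suc 1) / fact 1"
    by (rule Taylor_exp_field)
  then have 1: "norm (exp w - 1 - w) \<le> exp (norm w) * norm w * norm w"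
    by (simp add: power2_eq_square algebra_simps)
  have "exp (norm w) \<le> exp (1/4)" using assms by simp
  also have "\<dots> \<le> 2" using exp_bound[of "1/4"] by (simp add: power2_eq_square)
  finally have "exp (norm w) * norm w \<le> 2 * (1/4)" using assms by (intro mult_mono) auto
  then have "exp (norm w) * norm w * norm w \<le> 2 * (1/4) * norm w" by (intro mult_right_mono) auto
  with 1 have 2: "norm (exp w - 1 - w) \<le> norm w / 2" by simp
  show "norm (exp w - 1) \<le> 2 * norm w"
    using norm_triangle_ineq[of "exp w - 1 - w" w] 2 norm_ge_zero[of w] unfolding diff_add_cancel by linarith
  show "norm w / 2 \<le> norm (exp w - 1)"
    using norm_triangle_ineq2[of w "w - (exp w - 1)"] 2 norm_minus_commute[of "exp w - 1" w] by simp
qed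

lemma Re_divide_add_nonneg:
  assumes "Re z > 0" "r > 0"
  shows "Re (z / (z + of_real r)) \<ge> 0"
proof -
  have "Re (z / (z + of_real r)) = (Re z * (Re z + r) + Im z * Im z) / (norm (z + of_real r))^2"
    by (simp add: Re_divide cmod_power2)
  then show ?thesis using assms by simp
qed

text \<open>The map z / (z + r) takes the circle of radius r about 0 to the line Re = 1/2 and
  infinity to 1.\<close>

lemma Re_divide_add_ge_half:
  assumes "Re z > 0" "r > 0" "norm z \<ge> r"
  shows "Re (z / (z + of_real r)) \<ge> 1/2"
proof -
  have ne: "z + of_real r \<noteq> 0" using assms by (auto simp: complex_eq_iff)
  have "r^2 \<le> (norm z)^2" using assms by (intro power_mono) auto
  then have "(norm (z + of_real r))^2 \<le> 2 * (Re z * (Re z + r) + Im z * Im z)"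
    unfolding cmod_power2 by (simp add: power2_eq_square algebra_simps)
  then have "1/2 \<le> (Re z * (Re z + r) + Im z * Im z) / (norm (z + of_real r))^2"
    using ne by (simp add: field_simps)
  also have "\<dots> = Re (z / (z + of_real r))"
    by (simp add: Re_divide cmod_power2)
  finally show ?thesis .
qed

text \<open>The bound is by the real part of the term, not by its norm, so that it can be summed
  over all zeros: the real parts add up to \<open>Re (F' a - 2)\<close>. In the sector
  \<open>\<bar>Im a\<bar> \<le> Re a\<close> norm and real part are comparable.\<close>

lemma norm_divide_add_diff_le:
  assumes a: "\<bar>Im a\<bar> \<le> Re a" "a \<noteq> 0" and z: "Re z > 0" and r: "r > 0"
  shows "norm (z / (z + of_real r) - a / (a + of_real r)) \<le> 3/2 * norm (z / a - 1) * Re (a / (a + of_real r))"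
proof -
  have a0: "Re a > 0" using a by (auto simp: complex_eq_iff abs_if split: if_splits)
  have ne: "a + of_real r \<noteq> 0" "z + of_real r \<noteq> 0" using a0 z r by (auto simp: complex_eq_iff)
  have zr: "r \<le> norm (z + of_real r)" using abs_Re_le_cmod[of "z + of_real r"] z r by auto
  have "(Im a)^2 \<le> (Re a)^2" using a(1) by (simp add: abs_le_square_iff[symmetric])
  moreover have "(3/2 * Re a)^2 = 9/4 * (Re a)^2" unfolding power2_eq_square by simp
  ultimately have "(norm a)^2 \<le> (3/2 * Re a)^2"
    using cmod_power2[of a] zero_le_power2[of "Re a"] by linarith
  then have ra: "norm a \<le> 3/2 * Re a" by (rule power2_le_imp_le) (use a0 in simp)
  have "z / (z + of_real r) - a / (a + of_real r) = of_real r * (z - a) / ((z + of_real r) * (a + of_real r))"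
    using ne by (simp add: field_simps)
  then have "norm (z / (z + of_real r) - a / (a + of_real r)) 
     = r / norm (z + of_real r) * (norm (z - a) / norm (a + of_real r))"
    using r by (simp add: norm_mult norm_divide)
  also have "\<dots> \<le> 1 * (norm (z - a) / norm (a + of_real r))"
    using zr r ne by (intro mult_right_mono) (auto simp: field_simps)
  also have "norm (z - a) = norm (z / a - 1) * norm a" 
    using a(2) by (simp add: norm_mult[symmetric] algebra_simps)
  also have "1 * (norm (z / a - 1) * norm a / norm (a + of_real r)) = norm (z / a - 1) * (norm a / norm (a + of_real r))" by simp
  also have "\<dots> \<le> norm (z / a - 1) * (3/2 * Re (a / (a + of_real r)))"
  proof (rule mult_left_mono)
    have "norm a * norm (a + of_real r) \<le> norm a * (norm a + r)"
      using norm_triangle_ineq[of a "of_real r"] r by (intro mult_left_mono) auto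
    also have "\<dots> = (norm a)^2 + norm a * r" by (simp add: power2_eq_square algebra_simps)
    also have "\<dots> \<le> 3/2 * (norm a)^2 + (3/2 * Re a) * r"
      using ra r by (intro add_mono mult_right_mono) auto
    also have "\<dots> = 3/2 * (Re a * (Re a + r) + Im a * Im a)"
      unfolding cmod_power2 by (simp add: power2_eq_square algebra_simps)
    finally have "norm a / norm (a + of_real r) \<le> 3/2 * ((Re a * (Re a + r) + Im a * Im a) / (norm (a + of_real r))^2)"
      using ne by (simp add: field_simps power2_eq_square)
    also have "(Re a * (Re a + r) + Im a * Im a) / (norm (a + of_real r))^2 = Re (a / (a + of_real r))"
      by (simp add: Re_divide cmod_power2)
    finally show "norm a / norm (a + of_real r) \<le> 3/2 * Re (a / (a + of_real r))" .
  qed simp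
  finally show ?thesis by simp
qed

text \<open>The exponential maps it to the right half-plane, where every factor 1 + z / p k has
  positive real part and hence a holomorphic principal logarithm.\<close>

definition strip :: "complex set" where
  "strip = {\<zeta>. \<bar>Im \<zeta>\<bar> < pi / 2}"

lemma open_abs_Im_less: "open {z. \<bar>Im z\<bar> < c}" and convex_abs_Im_less: "convex {z. \<bar>Im z\<bar> < c}"
proof -
  have e: "{z. \<bar>Im z\<bar> < c} = {z. Im z < c} \<inter> {z. Im z > - c}" by auto
  show "open {z. \<bar>Im z\<bar> < c}" 
    unfolding e by (intro open_Int open_halfspace_Im_lt open_halfspace_Im_gt)
  show "convex {z. \<bar>Im z\<bar> < c}" 
    unfolding e by (intro convex_Int convex_halfspace_Im_lt convex_halfspace_Im_gt)
qed

lemma strip_convex: "convex strip" and open_strip: "open strip"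
  unfolding strip_def by (rule convex_abs_Im_less open_abs_Im_less)+

lemma Re_exp_pos: "\<zeta> \<in> strip \<Longrightarrow> Re (exp \<zeta>) > 0"
  unfolding strip_def Re_exp by (auto intro!: mult_pos_pos cos_gt_zero_pi)

section \<open>The lift of \<open>f\<close> and its expansion\<close>

context baker
begin

definition F :: "complex \<Rightarrow> complex" where
  "F \<zeta> = of_real (ln C) + 2 * \<zeta> + (\<Sum>k. Ln (1 + exp \<zeta> / of_real (p k)))"

definition F' :: "complex \<Rightarrow> complex" where
  "F' \<zeta> = 2 + (\<Sum>k. exp \<zeta> / (exp \<zeta> + of_real (p k)))"

lemma F_series:
  assumes \<zeta>: "\<zeta> \<in> strip"
  shows "(\<lambda>k. Ln (1 + exp \<zeta> / of_real (p k))) sums (F \<zeta> - (of_real (ln C) + 2 * \<zeta>))"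
    and "(\<lambda>k. exp \<zeta> / (exp \<zeta> + of_real (p k))) sums (F' \<zeta> - 2)"
    and "(F has_field_derivative F' \<zeta>) (at \<zeta>)"
proof -
  have "\<exists>g g'. \<forall>x \<in> strip. ((\<lambda>n. Ln (1 + exp x / of_real (p n))) sums g x) \<and> 
     ((\<lambda>n. exp x / (exp x + of_real (p n))) sums g' x) \<and> (g has_field_derivative g' x) (at x)"
  proof (rule series_and_derivative_comparison_complex[OF open_strip])
    fix n x assume x: "x \<in> strip"
    have re: "Re (1 + exp x / of_real (p n)) > 0"
      using Re_exp_pos[OF x] by (simp add: add_pos_pos)
    then have "1 + exp x / of_real (p n) \<notin> \<real>\<^sub>\<le>\<^sub>0"
      by (auto simp: complex_nonpos_Reals_iff)
    moreover from re have "1 + exp x / of_real (p n) \<noteq> 0" by (metis less_irrefl zero_complex.sel(1))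
    moreover have "exp x + of_real (p n) \<noteq> 0" using Re_exp_pos[OF x] p_pos[of n]
      by (auto simp: complex_eq_iff simp del: p_pos)
    ultimately show "((\<lambda>x. Ln (1 + exp x / of_real (p n))) has_field_derivative exp x / (exp x + of_real (p n))) (at x)"
      by (auto intro!: derivative_eq_intros simp: field_simps)
  next
    fix x :: complex
    define B where "B = exp (Re x + 1)"
    have "\<forall>\<^sub>F n in sequentially. 1 / p n < 1 / (2 * B)"
      by (rule order_tendstoD(2)[OF summable_LIMSEQ_zero[OF summable_inverse_p]]) (simp add: B_def)
    then have ev: "\<forall>\<^sub>F n in sequentially. 2 * B < p n"
      by eventually_elim (simp add: B_def field_simps)
    have "\<forall>\<^sub>F n in sequentially. \<forall>y\<in>ball x 1 \<inter> strip. cmod (Ln (1 + exp y / of_real (p n))) \<le> cmod (of_real (2 * (B * (1 / p n))))"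
      using ev
    proof eventually_elim
      case (elim n)
      show ?case
      proof
        fix y assume "y \<in> ball x 1 \<inter> strip"
        then have "\<bar>Re (x - y)\<bar> \<le> 1" using abs_Re_le_cmod[of "x - y"] by (auto simp: dist_norm)
        then have y: "norm (exp y) \<le> B" by (simp add: B_def)
        then have y2: "norm (exp y / of_real (p n)) \<le> B * (1 / p n)"
          by (simp add: norm_divide divide_right_mono)
        also have "\<dots> < 1/2" using elim by (simp add: field_simps)
        finally have "norm (Ln (1 + exp y / of_real (p n))) \<le> 2 * norm (exp y / of_real (p n))"
          by (rule norm_Ln_le)
        also have "\<dots> \<le> 2 * (B * (1 / p n))" using y2 by simp
        also have "\<dots> = cmod (of_real (2 * (B * (1 / p n))))"
          by (subst norm_of_real) (simp add: B_def)
        finally show "cmod (Ln (1 + exp y / of_real (p n))) \<le> cmod (of_real (2 * (B * (1 / p n))))" .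
      qed
    qed
    moreover have "summable (\<lambda>n. complex_of_real (2 * (B * (1 / p n))))"
      by (intro summable_of_real summable_mult summable_inverse_p)
    moreover have "range (\<lambda>n. complex_of_real (2 * (B * (1 / p n)))) \<subseteq> \<real>\<^sub>\<ge>\<^sub>0"
      by (auto simp: B_def complex_nonneg_Reals_iff)
    ultimately show "\<exists>d h. 0 < d \<and> summable h \<and> range h \<subseteq> \<real>\<^sub>\<ge>\<^sub>0 \<and>
        (\<forall>\<^sub>F n in sequentially. \<forall>y\<in>ball x d \<inter> strip. cmod (Ln (1 + exp y / of_real (p n))) \<le> cmod (h n))"
      by (intro exI[of _ 1] exI[of _ "\<lambda>n. complex_of_real (2 * (B * (1 / p n)))"]) simp
  qed
  then obtain g g' where g: "\<And>x. x \<in> strip \<Longrightarrow> (\<lambda>n. Ln (1 + exp x / of_real (p n))) sums g x"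
    "\<And>x. x \<in> strip \<Longrightarrow> (\<lambda>n. exp x / (exp x + of_real (p n))) sums g' x"
    "\<And>x. x \<in> strip \<Longrightarrow> (g has_field_derivative g' x) (at x)" by blast
  have F: "F x = of_real (ln C) + 2 * x + g x" if "x \<in> strip" for x
    using sums_unique[OF g(1)[OF that]] by (simp add: F_def)
  have F': "F' x = 2 + g' x" if "x \<in> strip" for x
    using sums_unique[OF g(2)[OF that]] by (simp add: F'_def)
  show "(\<lambda>k. Ln (1 + exp \<zeta> / of_real (p k))) sums (F \<zeta> - (of_real (ln C) + 2 * \<zeta>))"
    "(\<lambda>k. exp \<zeta> / (exp \<zeta> + of_real (p k))) sums (F' \<zeta> - 2)"
    using g[OF \<zeta>] F[OF \<zeta>] F'[OF \<zeta>] by auto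
  have "((\<lambda>x. of_real (ln C) + 2 * x + g x) has_field_derivative F' \<zeta>) (at \<zeta>)"
    using g(3)[OF \<zeta>] F'[OF \<zeta>] by (auto intro!: derivative_eq_intros)
  then show "(F has_field_derivative F' \<zeta>) (at \<zeta>)"
    by (rule has_field_derivative_transform_within_open[OF _ open_strip \<zeta>]) (simp add: F)
qed

lemma exp_F: 
  assumes \<zeta>: "\<zeta> \<in> strip"
  shows "exp (F \<zeta>) = f (exp \<zeta>)"
proof -
  have "(\<lambda>n. exp (of_real (ln C) + 2 * \<zeta> + (\<Sum>k<n. Ln (1 + exp \<zeta> / of_real (p k))))) 
     \<longlonglongrightarrow> exp (of_real (ln C) + 2 * \<zeta> + (F \<zeta> - (of_real (ln C) + 2 * \<zeta>)))"
    using F_series(1)[OF \<zeta>] unfolding sums_def by (intro tendsto_intros)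
  moreover have "exp (of_real (ln C) + 2 * \<zeta> + (\<Sum>k<n. Ln (1 + exp \<zeta> / of_real (p k))))
     = of_real C * (exp \<zeta>)^2 * (\<Prod>k<n. 1 + exp \<zeta> / of_real (p k))" for n
  proof -
    have "1 + exp \<zeta> / of_real (p k) \<noteq> 0" for k
    proof -
      have "Re (1 + exp \<zeta> / of_real (p k)) > 0"
        using Re_exp_pos[OF \<zeta>] by (simp add: add_pos_pos)
      then show ?thesis by (metis less_irrefl zero_complex.sel(1))
    qed
    moreover have "exp (of_real (ln C)) = complex_of_real C"
      using Cpos by (simp add: exp_of_real)
    ultimately show ?thesis by (simp add: exp_add exp_sum exp_double)
  qed
  ultimately have "(\<lambda>n. of_real C * (exp \<zeta>)^2 * (\<Prod>k<n. 1 + exp \<zeta> / of_real (p k))) \<longlonglongrightarrow> exp (F \<zeta>)"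
    by simp
  then show ?thesis using f_partial LIMSEQ_unique by blast
qed

lemma F_of_real: "Im (F (of_real x)) = 0"
proof -
  have s: "of_real x \<in> strip" by (simp add: strip_def)
  have "(\<lambda>k. Im (Ln (1 + exp (complex_of_real x) / of_real (p k)))) sums Im (F (of_real x) - (of_real (ln C) + 2 * of_real x))"
    using F_series(1)[OF s] by (rule sums_Im)
  moreover have "Im (Ln (1 + exp (complex_of_real x) / of_real (p k))) = 0" for k
  proof -
    have "1 + exp (complex_of_real x) / of_real (p k) = of_real (1 + exp x / p k)"
      by (simp add: exp_of_real)
    moreover have "1 + exp x / p k > 0" by (simp add: add_pos_pos)
    ultimately show ?thesis by (metis Im_Ln_of_real Im_complex_of_real Ln_of_real)
  qed
  ultimately have "Im (F (of_real x) - (of_real (ln C) + 2 * of_real x)) = 0"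
    using sums_unique2[OF sums_zero] by (metis (no_types, lifting) sums_cong)
  then show ?thesis by simp
qed

lemma Re_F'_ge_2: 
  assumes "\<zeta> \<in> strip"
  shows "Re (F' \<zeta>) \<ge> 2"
proof -
  have "Re (F' \<zeta> - 2) \<ge> 0"
    using sums_Re[OF F_series(2)[OF assms]] 
    by (rule sums_le[OF _ sums_zero, rotated]) (use Re_divide_add_nonneg[OF Re_exp_pos[OF assms]] in auto)
  then show ?thesis by simp
qed

text \<open>The eight zeros \<open>- p 0\<close>, ..., \<open>- p 7\<close> have been passed and
  contribute at least 1/2 each. The value 6 is what takes the line Im = pi/4 out to Im = 3
  pi/2.\<close>

lemma Re_F'_ge_6: 
  assumes "\<zeta> \<in> strip" "Re \<zeta> \<ge> ln (p 7)"
  shows "Re (F' \<zeta>) \<ge> 6"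
proof -
  have pos: "Re (exp \<zeta>) > 0" by (rule Re_exp_pos[OF assms(1)])
  note sm = sums_Re[OF F_series(2)[OF assms(1)]]
  have "4 = (\<Sum>k<8::nat. 1/2::real)" by simp
  also have "\<dots> \<le> (\<Sum>k<8. Re (exp \<zeta> / (exp \<zeta> + of_real (p k))))"
  proof (rule sum_mono)
    fix k :: nat assume "k \<in> {..<8}"
    then have "p k \<le> p 7" by (intro p_mono) auto
    also have "p 7 = exp (ln (p 7))" by simp
    also have "\<dots> \<le> exp (Re \<zeta>)" using assms(2) by (subst exp_le_cancel_iff)
    finally show "1/2 \<le> Re (exp \<zeta> / (exp \<zeta> + of_real (p k)))"
      by (intro Re_divide_add_ge_half pos) auto
  qed
  also have "\<dots> \<le> Re (F' \<zeta> - 2)"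
    unfolding sums_unique[OF sm] 
    by (intro sum_le_suminf) (use sm Re_divide_add_nonneg[OF pos] in \<open>auto simp: summable_def\<close>)
  finally show ?thesis by simp
qed

lemma F_expand:
  assumes "a \<in> strip" "b \<in> strip"
  shows "2 * norm (b - a) \<le> norm (F b - F a)"
proof -
  have "2 * (norm (b - a))^2 \<le> Re ((F b - F a) * cnj (b - a))"
    by (rule Re_has_field_derivative_lower[OF strip_convex assms F_series(3) Re_F'_ge_2])
  also have "\<dots> \<le> norm (F b - F a) * norm (b - a)"
    by (metis complex_Re_le_cmod norm_mult complex_mod_cnj)
  finally have "2 * norm (b - a) * norm (b - a) \<le> norm (F b - F a) * norm (b - a)"
    by (simp add: power2_eq_square)
  then show ?thesis by (cases "b = a") auto
qed

text \<open>Compare \<open>\<zeta>\<close> with its real part, where \<open>F\<close> is real: on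
  the vertical segment between them the lower bound for the derivative concerns imaginary parts
  only.\<close>

lemma Im_F_ge:
  assumes \<zeta>: "\<zeta> \<in> strip" and Q: "convex Q" "\<zeta> \<in> Q" "of_real (Re \<zeta>) \<in> Q" "Q \<subseteq> strip"
    and "\<And>z. z \<in> Q \<Longrightarrow> \<kappa> \<le> Re (F' z)"
  shows "\<kappa> * \<bar>Im \<zeta>\<bar> \<le> \<bar>Im (F \<zeta>)\<bar>"
proof -
  have e: "\<zeta> - of_real (Re \<zeta>) = \<i> * of_real (Im \<zeta>)" by (simp add: complex_eq_iff)
  have "\<kappa> * (norm (\<zeta> - of_real (Re \<zeta>)))^2 \<le> Re ((F \<zeta> - F (of_real (Re \<zeta>))) * cnj (\<zeta> - of_real (Re \<zeta>)))"
    by (rule Re_has_field_derivative_lower[OF Q(1,3,2) F_series(3)]) (use assms in auto)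
  also have "\<dots> = Im (F \<zeta>) * Im \<zeta>"
    unfolding e using F_of_real[of "Re \<zeta>"] by simp
  also have "\<dots> \<le> \<bar>Im (F \<zeta>)\<bar> * \<bar>Im \<zeta>\<bar>" by (metis abs_ge_self abs_mult)
  also have "(norm (\<zeta> - of_real (Re \<zeta>)))^2 = \<bar>Im \<zeta>\<bar> * \<bar>Im \<zeta>\<bar>" 
    unfolding e by (simp add: norm_mult power2_eq_square)
  finally have "\<kappa> * \<bar>Im \<zeta>\<bar> * \<bar>Im \<zeta>\<bar> \<le> \<bar>Im (F \<zeta>)\<bar> * \<bar>Im \<zeta>\<bar>" by simp
  then show ?thesis by (cases "Im \<zeta> = 0") auto
qed

lemma Im_F_ge_2: "\<zeta> \<in> strip \<Longrightarrow> 2 * \<bar>Im \<zeta>\<bar> \<le> \<bar>Im (F \<zeta>)\<bar>"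
  by (rule Im_F_ge[OF _ strip_convex]) (auto intro: Re_F'_ge_2, auto simp: strip_def)

lemma Im_F_ge_6: 
  assumes "\<zeta> \<in> strip" "Re \<zeta> \<ge> ln (p 7)"
  shows "6 * \<bar>Im \<zeta>\<bar> \<le> \<bar>Im (F \<zeta>)\<bar>"
proof (rule Im_F_ge[OF assms(1)])
  show "convex (strip \<inter> {z. Re z \<ge> ln (p 7)})"
    by (intro convex_Int strip_convex convex_halfspace_Re_ge)
qed (use assms in \<open>auto intro: Re_F'_ge_6, auto simp: strip_def\<close>)

lemma Re_F_le_real: 
  assumes "\<zeta> \<in> strip"
  shows "Re (F \<zeta>) \<le> Re (F (of_real (Re \<zeta>)))"
proof -
  have "norm (exp (F \<zeta>)) \<le> norm (exp (F (of_real (Re \<zeta>))))"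
    using norm_f_le_f_norm[of "exp \<zeta>"] exp_F[OF assms] exp_F[of "of_real (Re \<zeta>)"]
    by (simp add: strip_def exp_of_real)
  then show ?thesis by simp
qed

lemma Re_F_mono:
  assumes "x \<le> y"
  shows "Re (F (of_real x)) \<le> Re (F (of_real y))"
proof (cases "x = y")
  case False
  have "2 * (norm (of_real y - of_real x :: complex))^2 \<le> Re ((F (of_real y) - F (of_real x)) * cnj (of_real y - of_real x))"
    by (rule Re_has_field_derivative_lower[OF strip_convex _ _ F_series(3) Re_F'_ge_2]) (auto simp: strip_def)
  also have "\<dots> = (Re (F (of_real y)) - Re (F (of_real x))) * (y - x)" by simp
  finally have "0 \<le> (Re (F (of_real y)) - Re (F (of_real x))) * (y - x)"
    by (rule order_trans[rotated]) simp
  then show ?thesis using False assms by (simp add: zero_le_mult_iff)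
qed auto

section \<open>The inverse branch\<close>

definition M :: real where "M = Re (F (of_real (ln (p 7))))"

text \<open>Half as wide as \<open>strip\<close>, because \<open>F\<close> at least doubles
  imaginary parts. In addition, its image under exp lies in the sector that the distortion estimate
  requires.\<close>

definition S :: "complex set" where "S = {\<zeta>. \<bar>Im \<zeta>\<bar> < pi / 4}"

text \<open>Besides the strip containing the backward orbits, the domain of the inverse branch has to
  contain the logarithms of discs around the points \<open>- p m\<close>, which have imaginary part near \<open>pi\<close>.\<close>

definition D :: "complex set" where 
  "D = {w. \<bar>Im w\<bar> < pi / 2} \<union> {w. M < Re w \<and> \<bar>Im w\<bar> < 3 * pi / 2}"

lemma S_subset_strip: "S \<subseteq> strip" and strip_subset_D: "strip \<subseteq> D"
  by (auto simp: S_def strip_def D_def)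

lemma open_S: "open S"
  unfolding S_def by (rule open_abs_Im_less)

lemma connected_D: "connected D"
proof -
  have "convex ({w. M < Re w} \<inter> {w. \<bar>Im w\<bar> < 3 * pi / 2})"
    by (intro convex_Int convex_halfspace_Re_gt convex_abs_Im_less)
  then have "connected {w. M < Re w \<and> \<bar>Im w\<bar> < 3 * pi / 2}"
    by (intro convex_connected) (simp add: Collect_conj_eq)
  moreover have "connected {w. \<bar>Im w\<bar> < pi / 2}" by (intro convex_connected convex_abs_Im_less)
  moreover have "of_real (M + 1) \<in> {w. \<bar>Im w\<bar> < pi / 2} \<inter> {w. M < Re w \<and> \<bar>Im w\<bar> < 3 * pi / 2}"
    by auto
  ultimately show ?thesis unfolding D_def by (metis (no_types, lifting) connected_Un emptyE)
qed

text \<open>Factor 2 takes pi/4 to at least pi/2, which excludes the strip; to the right of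
  \<open>M\<close> factor 6 takes it to at least 3 pi/2, which excludes the wider part of
  \<open>D\<close>.\<close>

lemma F_frontier_notin_D:
  assumes "\<bar>Im \<zeta>\<bar> = pi / 4"
  shows "F \<zeta> \<notin> D"
proof
  assume D: "F \<zeta> \<in> D"
  have s: "\<zeta> \<in> strip" unfolding strip_def mem_Collect_eq assms using pi_gt_zero by linarith
  have "\<bar>Im (F \<zeta>)\<bar> \<ge> pi / 2" using Im_F_ge_2[OF s] assms by simp
  then have m: "M < Re (F \<zeta>)" "\<bar>Im (F \<zeta>)\<bar> < 3 * pi / 2" using D by (auto simp: D_def)
  \<comment> \<open>\<open>Re F\<close> is at most its value at the real point below, and this value
    increases with the real part; so a value above \<open>M\<close> can only come from the region of
    expansion 6.\<close>
  have "ln (p 7) \<le> Re \<zeta>"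
  proof (rule ccontr)
    assume "\<not> ln (p 7) \<le> Re \<zeta>"
    then have "Re (F (of_real (Re \<zeta>))) \<le> M" unfolding M_def by (intro Re_F_mono) auto
    then show False using m Re_F_le_real[OF s] by simp
  qed
  then show False using Im_F_ge_6[OF s] assms m by simp
qed

lemma continuous_on_F: "A \<subseteq> strip \<Longrightarrow> continuous_on A F"
  using F_series(3) by (meson DERIV_isCont continuous_at_imp_continuous_on subset_iff)

lemma inj_on_F: "inj_on F strip"
  using F_expand by (fastforce intro!: inj_onI)

lemma F_covers_D: "D \<subseteq> F ` S"
proof -
  have "open (F ` S)"
    using S_subset_strip by (intro invariance_of_domain open_S continuous_on_F inj_on_subset[OF inj_on_F])
  then have 1: "openin (top_of_set D) (D \<inter> F ` S)" by (rule openin_open_Int)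
  have 2: "closedin (top_of_set D) (D \<inter> F ` S)"
  proof -
    have "closure (F ` S) \<inter> D \<subseteq> F ` S"
    proof
      fix w assume w: "w \<in> closure (F ` S) \<inter> D"
      then have "w \<in> closure (F ` S)" by simp
      then obtain y where "\<forall>n. y n \<in> F ` S" and y: "y \<longlonglongrightarrow> w" 
        unfolding closure_sequential by (elim exE conjE)
      then have "\<forall>n. \<exists>x. x \<in> S \<and> y n = F x" by (simp add: image_iff Bex_def)
      then obtain x where x: "\<And>n. x n \<in> S" "\<And>n. y n = F (x n)" by (auto dest!: choice)
      have "Cauchy y" using y by (rule LIMSEQ_imp_Cauchy)
      have "Cauchy x"
      proof (rule metric_CauchyI)
        fix e :: real assume "e > 0"
        then obtain N where N: "\<forall>m\<ge>N. \<forall>n\<ge>N. dist (y m) (y n) < e" 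
          using \<open>Cauchy y\<close> metric_CauchyD by blast
        have "dist (x m) (x n) \<le> dist (y m) (y n)" for m n
          using F_expand[of "x n" "x m"] x S_subset_strip norm_ge_zero[of "x m - x n"] unfolding dist_norm x(2)
          by (smt (verit) subsetD)
        then show "\<exists>M. \<forall>m\<ge>M. \<forall>n\<ge>M. dist (x m) (x n) < e" using N by (meson le_less_trans)
      qed
      then obtain \<zeta> where \<zeta>: "x \<longlonglongrightarrow> \<zeta>" by (auto simp: Cauchy_convergent_iff convergent_def)
      have "\<bar>Im \<zeta>\<bar> \<le> pi / 4"
      proof (rule tendsto_upperbound)
        show "(\<lambda>n. \<bar>Im (x n)\<bar>) \<longlonglongrightarrow> \<bar>Im \<zeta>\<bar>" by (intro tendsto_intros \<zeta>)
        show "\<forall>\<^sub>F n in sequentially. \<bar>Im (x n)\<bar> \<le> pi / 4"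
          using x(1) by (intro always_eventually) (auto simp: S_def less_imp_le)
      qed auto
      then have s: "\<zeta> \<in> strip" using pi_gt_zero by (simp add: strip_def del: pi_gt_zero)
      then have "isCont F \<zeta>" by (rule DERIV_isCont[OF F_series(3)])
      then have "(\<lambda>n. F (x n)) \<longlonglongrightarrow> F \<zeta>" using \<zeta> isCont_tendsto_compose by blast
      then have "w = F \<zeta>" using y unfolding x(2)[symmetric] by (rule LIMSEQ_unique[rotated])
      moreover have "\<bar>Im \<zeta>\<bar> \<noteq> pi / 4" using F_frontier_notin_D w \<open>w = F \<zeta>\<close> by blast
      ultimately show "w \<in> F ` S" using \<open>\<bar>Im \<zeta>\<bar> \<le> pi / 4\<close> by (auto simp: S_def)
    qed
    then have "D \<inter> F ` S = D \<inter> closure (F ` S)" using closure_subset by blast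
    then show ?thesis by (metis closed_closure closedin_closed_Int)
  qed
  have "F (of_real 0) \<in> D \<inter> F ` S"
    using F_of_real[of 0] by (auto simp: D_def S_def)
  then have "D \<inter> F ` S = D" using connected_D 1 2 unfolding connected_clopen by blast
  then show ?thesis by blast
qed

definition G :: "complex \<Rightarrow> complex" where "G = inv_into S F"

lemma G: assumes "w \<in> D" shows "G w \<in> S" "F (G w) = w"
  using F_covers_D assms by (auto simp: G_def f_inv_into_f inv_into_into subset_iff)

lemma G_F: assumes "\<zeta> \<in> S" shows "G (F \<zeta>) = \<zeta>"
  unfolding G_def using assms S_subset_strip by (intro inv_into_f_f inj_on_subset[OF inj_on_F])

lemma G_contract:
  assumes "v \<in> D" "w \<in> D"
  shows "norm (G w - G v) \<le> norm (w - v) / 2"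
  using F_expand[of "G v" "G w"] G[OF assms(1)] G[OF assms(2)] subsetD[OF S_subset_strip] by simp

text \<open>The error is relative to \<open>norm (F' a)\<close> with a constant that does not depend
  on \<open>a\<close>, although \<open>F'\<close> is unbounded. This uniformity makes an elementary
  substitute for Koebe distortion possible along a whole backward orbit.\<close>

lemma F'_distortion:
  assumes a: "a \<in> S" and \<zeta>: "\<zeta> \<in> strip" "norm (\<zeta> - a) \<le> 1/4"
  shows "norm (F' \<zeta> - F' a) \<le> 3 * norm (\<zeta> - a) * norm (F' a)"
proof -
  have as: "a \<in> strip" using a S_subset_strip by auto
  have im: "\<bar>Im (exp a)\<bar> \<le> Re (exp a)"
  proof -
    have "\<bar>sin (Im a)\<bar> \<le> cos (Im a)"
    proof -
      have "cos (pi/2 - \<bar>Im a\<bar>) \<le> cos \<bar>Im a\<bar>"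
        using a by (intro cos_monotone_0_pi_le) (auto simp: S_def)
      moreover have "cos (pi/2 - \<bar>Im a\<bar>) = \<bar>sin (Im a)\<bar>"
        using a sin_ge_zero[of "\<bar>Im a\<bar>"] by (auto simp: cos_diff S_def abs_if split: if_splits)
      ultimately show ?thesis by simp
    qed
    then show ?thesis by (simp add: Re_exp Im_exp abs_mult)
  qed
  define T where "T z k = exp z / (exp z + of_real (p k))" for z :: complex and k
  have T\<zeta>: "(\<lambda>k. T \<zeta> k) sums (F' \<zeta> - 2)" and Ta: "(\<lambda>k. T a k) sums (F' a - 2)"
    unfolding T_def by (intro F_series as \<zeta>)+
  have le: "norm (T \<zeta> k - T a k) \<le> 3 * norm (\<zeta> - a) * Re (T a k)" for k
  proof -
    have "norm (T \<zeta> k - T a k) \<le> 3/2 * norm (exp \<zeta> / exp a - 1) * Re (T a k)"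
      unfolding T_def by (rule norm_divide_add_diff_le[OF im _ Re_exp_pos[OF \<zeta>(1)]]) auto
    also have "\<dots> \<le> 3/2 * (2 * norm (\<zeta> - a)) * Re (T a k)"
      using norm_exp_minus_one_bounds(1)[OF \<zeta>(2)] Re_divide_add_nonneg[OF Re_exp_pos[OF as]]
      by (intro mult_right_mono mult_left_mono) (auto simp: exp_diff T_def)
    finally show ?thesis by simp
  qed
  have sm: "(\<lambda>k. 3 * norm (\<zeta> - a) * Re (T a k)) sums (3 * norm (\<zeta> - a) * Re (F' a - 2))"
    by (intro sums_mult sums_Re Ta)
  have d: "(\<lambda>k. T \<zeta> k - T a k) sums (F' \<zeta> - 2 - (F' a - 2))" by (rule sums_diff[OF T\<zeta> Ta])
  have "norm (F' \<zeta> - F' a) = norm (\<Sum>k. T \<zeta> k - T a k)"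
    using sums_unique[OF d] by simp
  also have "\<dots> \<le> (\<Sum>k. 3 * norm (\<zeta> - a) * Re (T a k))"
    using le by (intro norm_suminf_le sums_summable[OF sm])
  also have "\<dots> = 3 * norm (\<zeta> - a) * Re (F' a - 2)" using sums_unique[OF sm] by simp
  also have "\<dots> \<le> 3 * norm (\<zeta> - a) * norm (F' a)"
    using complex_Re_le_cmod[of "F' a"] by (intro mult_left_mono) auto
  finally show ?thesis .
qed

lemma F_distortion:
  assumes a: "a \<in> S" and b: "b \<in> S" "norm (b - a) \<le> 1/4"
  shows "\<bar>norm (F b - F a) - norm (F' a) * norm (b - a)\<bar> \<le> 3 * norm (b - a) * (norm (F' a) * norm (b - a))"
proof -
  let ?Q = "strip \<inter> cball a (norm (b - a))"
  define h where "h z = F z - F' a * z" for z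
  have as: "a \<in> strip" "b \<in> strip" using a b S_subset_strip by auto
  have "norm (h b - h a) \<le> 3 * norm (b - a) * norm (F' a) * norm (b - a)"
  proof (rule field_differentiable_bound[of ?Q])
    fix z assume z: "z \<in> ?Q"
    have "(h has_field_derivative F' z - F' a * 1) (at z)"
      unfolding h_def using z by (intro DERIV_diff F_series(3) DERIV_cmult DERIV_ident) auto
    then show "(h has_field_derivative F' z - F' a) (at z within ?Q)"
      by (simp add: has_field_derivative_at_within)
    have z': "norm (z - a) \<le> norm (b - a)" using z by (simp add: dist_norm norm_minus_commute)
    then have "norm (F' z - F' a) \<le> 3 * norm (z - a) * norm (F' a)"
      using z b by (intro F'_distortion a) auto
    also have "\<dots> \<le> 3 * norm (b - a) * norm (F' a)" using z' by (intro mult_right_mono mult_left_mono) auto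
    finally show "norm (F' z - F' a) \<le> 3 * norm (b - a) * norm (F' a)" .
  qed (use as in \<open>auto intro!: convex_Int strip_convex simp: dist_norm norm_minus_commute\<close>)
  also have "h b - h a = (F b - F a) - F' a * (b - a)" by (simp add: h_def algebra_simps)
  finally have "norm ((F b - F a) - F' a * (b - a)) \<le> 3 * norm (b - a) * (norm (F' a) * norm (b - a))"
    by (simp only: mult.assoc)
  moreover have "\<bar>norm (F b - F a) - norm (F' a * (b - a))\<bar> \<le> norm ((F b - F a) - F' a * (b - a))"
    by (rule norm_triangle_ineq3)
  ultimately show ?thesis unfolding norm_mult by linarith
qed

end

section \<open>Escaping Fatou components and thin annuli\<close>

lemma fatou_setI_diverging:
  fixes f :: "complex \<Rightarrow> complex"
  assumes "open W"
    and div: "\<And>B. \<forall>\<^sub>F n in sequentially. \<forall>z\<in>W. B < norm ((f ^^ n) z)"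
  shows "W \<subseteq> fatou_set f"
proof
  fix z assume "z \<in> W"
  then obtain e where e: "e > 0" "ball z e \<subseteq> W" using \<open>open W\<close> openE by blast
  have "normal_on (ball z e) (range (\<lambda>n. f ^^ n))"
    unfolding normal_on_def
  proof (intro allI impI)
    fix g :: "nat \<Rightarrow> complex \<Rightarrow> complex" assume "range g \<subseteq> range (\<lambda>n. f ^^ n)"
    then have "\<forall>i. \<exists>n. g i = f ^^ n" by auto
    then obtain \<nu> where \<nu>: "\<And>i. g i = f ^^ \<nu> i" by metis
    show "\<exists>s :: nat \<Rightarrow> nat. strict_mono s \<and>
         ((\<exists>h. \<forall>K. compact K \<and> K \<subseteq> ball z e \<longrightarrow> uniform_limit K (\<lambda>n. g (s n)) h sequentially) \<or>
          (\<forall>K. compact K \<and> K \<subseteq> ball z e \<longrightarrow>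
             (\<forall>B. \<forall>\<^sub>F n in sequentially. \<forall>z\<in>K. B < norm (g (s n) z))))"
    \<comment> \<open>A sequence from the family may repeat one iterate infinitely often; then a
      constant subsequence converges. Otherwise the exponents tend to infinity and the divergence
      carries over.\<close>
    proof (cases "\<exists>v. infinite {i. \<nu> i = v}")
      case True
      then obtain v where v: "infinite {i. \<nu> i = v}" by blast
      have "g (enumerate {i. \<nu> i = v} n) = f ^^ v" for n
        using enumerate_in_set[OF v, of n] \<nu> by simp
      then have "uniform_limit K (\<lambda>n. g (enumerate {i. \<nu> i = v} n)) (f ^^ v) sequentially" for K
        by (simp add: uniform_limit_const)
      then show ?thesis using strict_mono_enumerate[OF v] by blast
    next
      case False
      have "\<forall>\<^sub>F i in sequentially. N \<le> \<nu> i" for N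
      proof -
        have "finite (\<Union>v<N. {i. \<nu> i = v})" using False by auto
        then have "finite {i. \<not> N \<le> \<nu> i}" by (rule rev_finite_subset) auto
        then show ?thesis by (simp add: eventually_cofinite flip: cofinite_eq_sequentially)
      qed
      then have top: "filterlim \<nu> at_top sequentially" by (simp add: filterlim_at_top)
      have "\<forall>\<^sub>F n in sequentially. \<forall>z\<in>W. B < norm (g n z)" for B
        unfolding \<nu> using div[of B] top by (rule eventually_compose_filterlim)
      then have "\<forall>\<^sub>F n in sequentially. \<forall>w\<in>K. B < norm (g (id n) w)" if "K \<subseteq> ball z e" for K B
        using that e(2) by (fastforce elim: eventually_mono)
      moreover have "strict_mono (id :: nat \<Rightarrow> nat)" by (simp add: strict_mono_def)
      ultimately show ?thesis by blast
    qed
  qed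
  then show "z \<in> fatou_set f" using e(1) by (auto simp: fatou_set_def)
qed

text \<open>If \<open>v\<close> does not escape, some subsequence of the iterates is bounded at
  \<open>v\<close>. A further subsequence given by normality cannot have a finite limit, because of
  \<open>u\<close>, nor tend to infinity, because of \<open>v\<close>.\<close>

lemma escaping_in_normal_disc:
  fixes f :: "complex \<Rightarrow> complex"
  assumes norm: "normal_on (ball z e) (range (\<lambda>n. f ^^ n))"
    and uv: "u \<in> ball z e" "v \<in> ball z e"
    and esc: "filterlim (\<lambda>n. (f ^^ n) u) at_infinity sequentially"
  shows "filterlim (\<lambda>n. (f ^^ n) v) at_infinity sequentially"
proof (rule ccontr)
  assume "\<not> ?thesis"
  then obtain B where "\<not> (\<forall>\<^sub>F n in sequentially. B \<le> norm ((f ^^ n) v))"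
    by (auto simp: filterlim_at_infinity[OF order_refl])
  then have inf: "infinite {n. norm ((f ^^ n) v) < B}"
    by (simp add: eventually_cofinite not_le flip: cofinite_eq_sequentially)
  define s0 where "s0 = enumerate {n. norm ((f ^^ n) v) < B}"
  have s0: "strict_mono s0" unfolding s0_def by (rule strict_mono_enumerate[OF inf])
  have B: "norm ((f ^^ s0 n) v) < B" for n
    using enumerate_in_set[OF inf, of n] by (simp add: s0_def)
  have "range (\<lambda>n. f ^^ s0 n) \<subseteq> range (\<lambda>n. f ^^ n)" by auto
  then obtain s :: "nat \<Rightarrow> nat" where s: "strict_mono s"
    and alt: "(\<exists>h. \<forall>K. compact K \<and> K \<subseteq> ball z e \<longrightarrow> uniform_limit K (\<lambda>n. f ^^ s0 (s n)) h sequentially) \<or>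
          (\<forall>K. compact K \<and> K \<subseteq> ball z e \<longrightarrow>
             (\<forall>B. \<forall>\<^sub>F n in sequentially. \<forall>z\<in>K. B < norm ((f ^^ s0 (s n)) z)))"
    using norm[unfolded normal_on_def, rule_format, of "\<lambda>n. f ^^ s0 n"] by blast
  from alt show False
  proof
    assume "\<exists>h. \<forall>K. compact K \<and> K \<subseteq> ball z e \<longrightarrow> uniform_limit K (\<lambda>n. f ^^ s0 (s n)) h sequentially"
    then obtain h where "compact {u} \<and> {u} \<subseteq> ball z e \<longrightarrow> uniform_limit {u} (\<lambda>n. f ^^ s0 (s n)) h sequentially"
      by (elim exE allE)
    then have "uniform_limit {u} (\<lambda>n. f ^^ s0 (s n)) h sequentially" using uv by simp
    then have "(\<lambda>n. (f ^^ s0 (s n)) u) \<longlonglongrightarrow> h u" by (rule tendsto_uniform_limitI) simp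
    moreover have "filterlim (\<lambda>n. s0 (s n)) at_top sequentially"
      using s s0 by (intro filterlim_subseq strict_monoI) (auto dest: strict_monoD)
    then have "filterlim (\<lambda>n. (f ^^ s0 (s n)) u) at_infinity sequentially"
      by (rule filterlim_compose[OF esc])
    ultimately show False using not_tendsto_and_filterlim_at_infinity trivial_limit_sequentially by blast
  next
    assume "\<forall>K. compact K \<and> K \<subseteq> ball z e \<longrightarrow>
             (\<forall>B. \<forall>\<^sub>F n in sequentially. \<forall>z\<in>K. B < norm ((f ^^ s0 (s n)) z))"
    then have "\<forall>\<^sub>F n in sequentially. \<forall>z\<in>{v}. B < norm ((f ^^ s0 (s n)) z)" 
      using uv by (elim allE[of _ "{v}"]) simp
    then obtain n where "B < norm ((f ^^ s0 (s n)) v)" 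
      by (auto simp: eventually_sequentially)
    then show False using B[of "s n"] by linarith
  qed
qed

lemma escaping_in_fatou_component:
  assumes U: "U \<in> fatou_components f" and uv: "u \<in> U" "v \<in> U"
    and esc: "filterlim (\<lambda>n. (f ^^ n) u) at_infinity sequentially"
  shows "filterlim (\<lambda>n. (f ^^ n) v) at_infinity sequentially"
proof -
  let ?P = "\<lambda>u. filterlim (\<lambda>n. (f ^^ n) u) at_infinity sequentially"
  have "connected U" "U \<subseteq> fatou_set f"
    using U by (auto simp: fatou_components_def in_components_connected dest: in_components_subset)
  show "?P v"
  proof (rule connected_induction_simple[where P = ?P, OF \<open>connected U\<close> uv esc])
    fix a assume "a \<in> U"
    then have "a \<in> fatou_set f" using \<open>U \<subseteq> fatou_set f\<close> by blast
    then obtain e where e: "e > 0" "normal_on (ball a e) (range (\<lambda>n. f ^^ n))"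
      by (auto simp: fatou_set_def)
    show "\<exists>T. openin (top_of_set U) T \<and> a \<in> T \<and> (\<forall>x\<in>T. \<forall>y\<in>T. ?P x \<longrightarrow> ?P y)"
    proof (intro exI[of _ "U \<inter> ball a e"] conjI ballI impI)
      fix x y assume "x \<in> U \<inter> ball a e" "y \<in> U \<inter> ball a e" "?P x"
      then show "?P y" by (intro escaping_in_normal_disc[OF e(2), of x y]) auto
    qed (use e(1) \<open>a \<in> U\<close> in \<open>auto intro: openin_open_Int\<close>)
  qed
qed

text \<open>The discs \<open>ball \<alpha> e\<close> rule out one-point components of the complement, for which shrinking annuli
  would not give infinitely many components.\<close>

lemma
  fixes U :: "complex set"
  assumes holes: "\<And>\<eta>. \<eta> > 0 \<Longrightarrow> \<exists>\<alpha> \<rho> R e. 0 < \<rho> \<and> \<rho> < \<eta> * R \<and> R < \<eta> \<and> 0 < e \<and> 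
     {z. \<rho> < norm (z - \<alpha>) \<and> norm (z - \<alpha>) < R} \<subseteq> U \<and> ball \<alpha> e \<inter> U = {}"
  shows not_uniformly_perfect_if_thin_annuli: "\<not> uniformly_perfect (frontier U)"
    and infinitely_connected_if_thin_annuli: "infinitely_connected U"
proof -
  \<comment> \<open>The segment from the hole into the annulus crosses the frontier, and the
    crossing point can lie neither in the open annulus nor in the disc of radius \<open>e\<close>.
    Both signs of \<open>t\<close> are allowed, which gives boundary points on opposite sides of the
    centre.\<close>
  have frontier_point: "\<exists>x. x \<in> frontier U \<and> x \<in> closed_segment \<alpha> (\<alpha> + of_real t) \<and> norm (x - \<alpha>) \<le> \<rho> \<and> e \<le> norm (x - \<alpha>)"
    if "{z. \<rho> < norm (z - \<alpha>) \<and> norm (z - \<alpha>) < R} \<subseteq> U" "ball \<alpha> e \<inter> U = {}" "e > 0" 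
      "\<rho> < \<bar>t\<bar>" "\<bar>t\<bar> < R" for \<alpha> \<rho> R e t
  proof -
    have "\<alpha> + of_real t \<in> U" using that by auto
    moreover have "\<alpha> \<notin> U" using that by (metis IntI centre_in_ball empty_iff)
    ultimately have "closed_segment \<alpha> (\<alpha> + of_real t) \<inter> frontier U \<noteq> {}"
      by (intro connected_Int_frontier) auto
    then obtain x where x: "x \<in> closed_segment \<alpha> (\<alpha> + of_real t)" "x \<in> frontier U" by blast
    have "norm (x - \<alpha>) \<le> \<bar>t\<bar>"
      using segment_bound(1)[OF x(1)] by simp
    moreover have "\<not> (\<rho> < norm (x - \<alpha>) \<and> norm (x - \<alpha>) < R)"
    proof
      assume "\<rho> < norm (x - \<alpha>) \<and> norm (x - \<alpha>) < R"
      moreover have "open {z. \<rho> < norm (z - \<alpha>) \<and> norm (z - \<alpha>) < R}"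
        by (intro open_Collect_conj open_Collect_less continuous_intros)
      ultimately have "x \<in> interior U" using that(1) by (intro interiorI) auto
      then show False using x(2) by (simp add: frontier_def)
    qed
    moreover have "e \<le> norm (x - \<alpha>)"
    proof (rule ccontr)
      assume "\<not> e \<le> norm (x - \<alpha>)"
      then have "x \<in> ball \<alpha> e" by (simp add: dist_norm norm_minus_commute)
      moreover have "ball \<alpha> e \<inter> closure U = {}" using that(2) by (simp add: open_Int_closure_eq_empty)
      ultimately show False using x(2) by (auto simp: frontier_def)
    qed
    ultimately show ?thesis using x that(5) by auto
  qed

  show "\<not> uniformly_perfect (frontier U)"
  proof
    assume "uniformly_perfect (frontier U)"
    then obtain c where c: "c > 0" and up: "\<And>a r. a \<in> frontier U \<Longrightarrow> r > 0 \<Longrightarrow> 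
        (bounded (frontier U) \<longrightarrow> r < diameter (frontier U)) \<Longrightarrow>
        {z. c * r < norm (z - a) \<and> norm (z - a) < r} \<inter> frontier U \<noteq> {}"
      unfolding uniformly_perfect_def by blast
    \<comment> \<open>A positive lower bound for the diameter of the frontier, needed to make small
      radii admissible. The two boundary points lie on opposite rays from the centre, and
      \<open>e\<close> keeps \<open>x\<close> away from the only common point.\<close>
    obtain d where d: "d > 0" "bounded (frontier U) \<longrightarrow> d \<le> diameter (frontier U)"
    proof -
      obtain \<alpha> \<rho> R e where A: "0 < \<rho>" "\<rho> < R" "0 < e"
        "{z. \<rho> < norm (z - \<alpha>) \<and> norm (z - \<alpha>) < R} \<subseteq> U" "ball \<alpha> e \<inter> U = {}"
        using holes[of 1] by auto
      obtain x where x: "x \<in> frontier U" "x \<in> closed_segment \<alpha> (\<alpha> + of_real ((\<rho> + R)/2))" "e \<le> norm (x - \<alpha>)"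
        using frontier_point[OF A(4,5,3), of "(\<rho> + R)/2"] A by auto
      obtain y where y: "y \<in> frontier U" "y \<in> closed_segment \<alpha> (\<alpha> + of_real (-(\<rho> + R)/2))"
        using frontier_point[OF A(4,5,3), of "-(\<rho> + R)/2"] A by auto
      have "x \<noteq> y"
      proof
        assume "x = y"
        obtain u where u: "0 \<le> u" "x = (1 - u) *\<^sub>R \<alpha> + u *\<^sub>R (\<alpha> + of_real ((\<rho> + R)/2))" 
          using x(2) by (auto simp: in_segment)
        obtain v where v: "0 \<le> v" "y = (1 - v) *\<^sub>R \<alpha> + v *\<^sub>R (\<alpha> + of_real (-(\<rho> + R)/2))" 
          using y(2) by (auto simp: in_segment)
        have re: "Re x = Re \<alpha> + u * ((\<rho> + R)/2)" "Re y = Re \<alpha> - v * ((\<rho> + R)/2)" and im: "Im x = Im \<alpha>"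
          unfolding u(2) v(2) by (auto simp: algebra_simps divide_simps)
        have "u * ((\<rho> + R)/2) \<ge> 0" "v * ((\<rho> + R)/2) \<ge> 0"
          using u(1) v(1) A by (auto intro!: mult_nonneg_nonneg)
        then have "Re x = Re \<alpha>" using re arg_cong[OF \<open>x = y\<close>, of Re] by linarith
        then have "x = \<alpha>" using im by (rule complex_eqI)
        then show False using x(3) A by simp
      qed
      then show ?thesis using x(1) y(1) diameter_bounded_bound[of "frontier U" x y] that[of "dist x y"] by auto
    qed
    \<comment> \<open>The three bounds serve to make \<open>R - \<rho>\<close> smaller than the
      diameter, \<open>\<rho>\<close> smaller than \<open>R / 2\<close>, and
      \<open>c * (R - \<rho>)\<close> larger than \<open>2 * \<rho>\<close>.\<close>
    define \<eta> where "\<eta> = min d (min (1/2) (c / 4))"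
    have \<eta>: "\<eta> > 0" "\<eta> \<le> d" "\<eta> \<le> 1/2" "\<eta> \<le> c / 4" using d c by (auto simp: \<eta>_def)
    obtain \<alpha> \<rho> R e where A: "0 < \<rho>" "\<rho> < \<eta> * R" "R < \<eta>" "0 < e"
        "{z. \<rho> < norm (z - \<alpha>) \<and> norm (z - \<alpha>) < R} \<subseteq> U" "ball \<alpha> e \<inter> U = {}"
      using holes[OF \<eta>(1)] by blast
    have "0 < \<eta> * R" using A by linarith
    then have R: "R > 0" using \<eta> by (simp add: zero_less_mult_iff)
    have "\<eta> * R \<le> 1/2 * R" "\<eta> * R \<le> c / 4 * R" using \<eta> R by (auto intro!: mult_right_mono)
    then have rho: "\<rho> < R / 2" "\<rho> < c / 4 * R" using A by linarith+
    obtain a where a: "a \<in> frontier U" "norm (a - \<alpha>) \<le> \<rho>"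
      using frontier_point[OF A(5,6,4), of "(\<rho> + R)/2"] rho R A(1) by auto
    \<comment> \<open>The frontier point \<open>a\<close> is up to \<open>\<rho>\<close> away from
      the centre of the annulus. Radius \<open>R - \<rho>\<close> about \<open>a\<close> keeps the
      point found below \<open>R\<close>, and a distance above \<open>2 * \<rho>\<close> from
      \<open>a\<close> keeps it above \<open>\<rho>\<close>.\<close>
    have "{z. c * (R - \<rho>) < norm (z - a) \<and> norm (z - a) < R - \<rho>} \<inter> frontier U \<noteq> {}"
      using a(1) rho R d A \<eta> by (intro up) auto
    then obtain z where z: "c * (R - \<rho>) < norm (z - a)" "norm (z - a) < R - \<rho>" "z \<in> frontier U" by blast
    have "c * (R / 2) \<le> c * (R - \<rho>)" using c rho by (intro mult_left_mono) auto
    then have "2 * \<rho> < norm (z - a)" using z(1) rho by (simp add: algebra_simps)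
    then have "\<rho> < norm (z - \<alpha>)" "norm (z - \<alpha>) < R"
      using norm_triangle_ineq[of "z - a" "a - \<alpha>"] norm_triangle_ineq[of "z - \<alpha>" "\<alpha> - a"] a(2) z(2)
      by (auto simp: norm_minus_commute)
    moreover have "open {z. \<rho> < norm (z - \<alpha>) \<and> norm (z - \<alpha>) < R}"
        by (intro open_Collect_conj open_Collect_less continuous_intros)
    ultimately have "z \<in> interior U" using A(5) by (intro interiorI) auto
    then show False using z(3) by (simp add: frontier_def)
  qed

  show "infinitely_connected U"
    unfolding infinitely_connected_def
  proof
    let ?X = "subtopology riemann_sphere (topspace riemann_sphere - Some ` U)"
    assume fin: "finite (connected_components_of ?X)"
    \<comment> \<open>Being squeezed between a disc and a closed disc of diameter below
      \<open>d\<close>. No single set is small at every scale, so finitely many components share a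
      scale at which none is small; a sufficiently thin hole then contradicts finiteness.\<close>
    define small where "small K d \<longleftrightarrow> (\<exists>\<alpha> \<rho> e. e > 0 \<and> 2 * \<rho> < d \<and> Some ` ball \<alpha> e \<subseteq> K \<and> K \<subseteq> Some ` cball \<alpha> \<rho>)"
      for K :: "complex option set" and d :: real
    have small_mono: "small K d'" if "small K d" "d \<le> d'" for K d d'
      using that unfolding small_def by (meson less_le_trans)
    have "\<exists>d>0. \<not> small K d" for K
    proof (rule ccontr)
      assume "\<not> ?thesis"
      then have sm: "small K d" if "d > 0" for d using that by blast
      obtain \<alpha> e where e: "e > 0" "Some ` ball \<alpha> e \<subseteq> K" using sm[of 1] by (auto simp: small_def)
      obtain \<beta> \<rho> where \<rho>: "2 * \<rho> < e / 2" "K \<subseteq> Some ` cball \<beta> \<rho>" using sm[of "e/2"] e by (auto simp: small_def)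
      have "ball \<alpha> e \<subseteq> cball \<beta> \<rho>" using e(2) \<rho>(2) by blast
      moreover have "\<alpha> \<in> ball \<alpha> e" "\<alpha> + of_real (e/2) \<in> ball \<alpha> e" using e(1) by (auto simp: dist_norm)
      ultimately have "\<alpha> \<in> cball \<beta> \<rho>" "\<alpha> + of_real (e/2) \<in> cball \<beta> \<rho>" by blast+
      then have "dist \<beta> \<alpha> \<le> \<rho>" "dist \<beta> (\<alpha> + of_real (e/2)) \<le> \<rho>" unfolding mem_cball .
      then have "dist \<alpha> (\<alpha> + of_real (e/2)) \<le> 2 * \<rho>" by metric
      then show False using \<rho>(1) e(1) by (simp add: dist_norm)
    qed
    then obtain d where d: "\<And>K. d K > 0 \<and> \<not> small K (d K)" by metis
    \<comment> \<open>Inserting 1 makes the set nonempty and bounds the scale by 1.\<close>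
    define \<eta> where "\<eta> = Min (insert 1 (d ` connected_components_of ?X))"
    have \<eta>: "\<eta> > 0" "\<eta> \<le> 1" "\<And>K. K \<in> connected_components_of ?X \<Longrightarrow> \<eta> \<le> d K"
      using fin d by (auto simp: \<eta>_def)
    obtain \<alpha> \<rho> R e where A: "0 < \<rho>" "\<rho> < \<eta> / 2 * R" "R < \<eta> / 2" "0 < e"
        "{z. \<rho> < norm (z - \<alpha>) \<and> norm (z - \<alpha>) < R} \<subseteq> U" "ball \<alpha> e \<inter> U = {}"
      using holes[of "\<eta>/2"] \<eta>(1) by auto
    have "0 < \<eta> / 2 * R" using A by linarith
    then have R: "R > 0" using \<eta> by (simp add: zero_less_mult_iff)
    have "\<eta> / 2 * R \<le> 1 * R" using \<eta> R by (intro mult_right_mono) auto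
    then have rho: "\<rho> < R" using A by simp
    let ?K = "connected_component_of_set ?X (Some \<alpha>)"
    have top: "topspace riemann_sphere = UNIV"
      unfolding riemann_sphere_def by (auto simp: notin_range_Some[symmetric])
    have cont: "continuous_map euclidean riemann_sphere Some"
      unfolding riemann_sphere_def by (rule continuous_map_Some)
    have "\<alpha> \<in> ball \<alpha> e" using A by simp
    then have "\<alpha> \<notin> U" using A(6) by blast
    then have \<alpha>: "Some \<alpha> \<in> topspace ?X" by (auto simp: top)
    have "connectedin ?X (Some ` ball \<alpha> e)"
      unfolding connectedin_subtopology
    proof
      show "connectedin riemann_sphere (Some ` ball \<alpha> e)"
        by (rule connectedin_continuous_map_image[OF cont]) simp
    qed (use A(6) top in auto)
    then have 1: "Some ` ball \<alpha> e \<subseteq> ?K"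
      by (rule connected_component_of_maximal) (use A in auto)
    have "?K \<subseteq> Some ` cball \<alpha> \<rho>"
    proof -
      let ?T = "(UNIV - Some ` U) \<inter> Some ` cball \<alpha> \<rho>"
      \<comment> \<open>Since the annulus lies in \<open>U\<close>, the closed inner disc and the
        open outer disc cut the same set out of the complement, which is therefore clopen and
        contains the whole component.\<close>
      have eq: "?T = (UNIV - Some ` U) \<inter> Some ` ball \<alpha> R"
        using A(5) rho by (fastforce simp: dist_norm norm_minus_commute not_le)
      have "openin riemann_sphere (Some ` ball \<alpha> R)" "closedin riemann_sphere (Some ` cball \<alpha> \<rho>)"
        unfolding riemann_sphere_def by auto
      then have "openin ?X ?T" "closedin ?X ?T"
        unfolding top by (auto simp: eq openin_subtopology_Int2 closedin_subtopology_Int_closed) 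
           (subst eq[symmetric], auto simp: closedin_subtopology_Int_closed)
      then have "?K \<subseteq> ?T \<or> disjnt ?K ?T"
        by (intro connectedin_clopen_cases[of ?X] connectedin_connected_component_of)
      moreover have "Some \<alpha> \<in> ?K" using \<alpha> by (simp add: connected_component_of_refl)
      moreover have "Some \<alpha> \<in> ?T" using \<alpha> A(1) by (auto simp: top)
      ultimately show ?thesis by (auto simp: disjnt_iff)
    qed
    then have "small ?K \<eta>" using 1 A rho unfolding small_def
      by (intro exI[of _ \<alpha>] exI[of _ \<rho>] exI[of _ e]) auto
    moreover have "?K \<in> connected_components_of ?X"
      using \<alpha> by (simp only: connected_component_in_connected_components_of)
    ultimately show False using small_mono \<eta>(3) d by blast
  qed
qed

section \<open>Pulling back annuli\<close>

context baker
begin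

lemma p_at_top: "filterlim p at_top sequentially"
proof (rule filterlim_at_top_mono[OF filterlim_real_sequentially])
  have "real n \<le> p n" for n
    using p_ge_two_pow[of n] of_nat_less_two_power[of n, where 'a = real] by linarith
  then show "\<forall>\<^sub>F n in sequentially. real n \<le> p n" by simp
qed

lemma p_add_ge_p: "p n \<le> p (m + n)"
  by (intro p_mono) auto

lemma fatou_set_if_iterate_into_L:
  assumes "open W" and N: "\<And>z. z \<in> W \<Longrightarrow> (f ^^ N) z \<in> L m"
  shows "W \<subseteq> fatou_set f"
proof (rule fatou_setI_diverging[OF \<open>open W\<close>])
  fix B :: real
  have "\<forall>\<^sub>F n in sequentially. B < p n" 
    using p_at_top by (simp add: filterlim_at_top_dense)
  then have "\<forall>\<^sub>F n in sequentially. B < p (n - N)"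
    using filterlim_minus_const_nat_at_top[of N] by (rule eventually_compose_filterlim)
  then show "\<forall>\<^sub>F n in sequentially. \<forall>z\<in>W. B < norm ((f ^^ n) z)"
    using eventually_ge_at_top[of N]
  proof eventually_elim
    case (elim n)
    show ?case
    proof
      fix z assume "z \<in> W"
      then have "(f ^^ (n - N)) ((f ^^ N) z) \<in> L (m + (n - N))" by (intro f_iter_L N)
      moreover have "(f ^^ (n - N)) ((f ^^ N) z) = (f ^^ n) z" 
        using elim funpow_add[of "n - N" N f] by (simp add: o_def)
      ultimately have "4 * p (m + (n - N)) < norm ((f ^^ n) z)" by (simp add: L_def)
      then show "B < norm ((f ^^ n) z)" using elim p_add_ge_p[of "n - N" m] p_pos[of "m + (n - N)"] by linarith
    qed
  qed
qed

lemma L_escaping: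
  assumes "z \<in> L m"
  shows "filterlim (\<lambda>n. (f ^^ n) z) at_infinity sequentially"
proof (rule filterlim_norm_at_top_imp_at_infinity, rule filterlim_at_top_mono[OF p_at_top])
  show "\<forall>\<^sub>F n in sequentially. p n \<le> norm ((f ^^ n) z)"
  proof (intro always_eventually allI)
    fix n
    have "4 * p (m + n) < norm ((f ^^ n) z)" using f_iter_L[OF assms, of n] by (simp add: L_def)
    then show "p n \<le> norm ((f ^^ n) z)" using p_add_ge_p[of n m] p_pos[of "m + n"] by linarith
  qed
qed

lemma f_neg_p: "f (- of_real (p m)) = 0"
proof -
  have "norm (f (- of_real (p m))) \<le> 0"
    using f_bounds(1)[of "- of_real (p m)" "Suc m"] by simp
  then show ?thesis by simp
qed

lemma not_escaping_near_preimage_of_0: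
  assumes "(f ^^ N) \<alpha> = 0"
  obtains e where "e > 0" "\<And>z. z \<in> ball \<alpha> e \<Longrightarrow> \<not> filterlim (\<lambda>n. (f ^^ n) z) at_infinity sequentially"
proof -
  have "open ((f ^^ N) -` ball 0 1)" 
    using continuous_on_f_iter[of UNIV N] by (intro open_vimage) auto
  moreover have "\<alpha> \<in> (f ^^ N) -` ball 0 1" using assms by simp
  ultimately obtain e where e: "e > 0" "ball \<alpha> e \<subseteq> (f ^^ N) -` ball 0 1" using openE by blast
  have "\<not> filterlim (\<lambda>n. (f ^^ n) z) at_infinity sequentially" if "z \<in> ball \<alpha> e" for z
  proof
    assume "filterlim (\<lambda>n. (f ^^ n) z) at_infinity sequentially"
    then have "\<forall>\<^sub>F n in sequentially. 2 \<le> norm ((f ^^ n) z)"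
      by (simp add: filterlim_at_infinity[of 0])
    then obtain n where n: "n \<ge> N" "2 \<le> norm ((f ^^ n) z)"
      unfolding eventually_sequentially by (meson le_cases)
    have "norm ((f ^^ (i + N)) z) \<le> 1" for i
      by (induction i) (use e(2) that in \<open>auto intro: basin\<close>)
    from this[of "n - N"] n show False by simp
  qed
  with e(1) show thesis by (rule that)
qed

section \<open>Iterates of the inverse branch\<close>

lemma G_iter:
  assumes "w \<in> D"
  shows "(G ^^ n) w \<in> D" and "(f ^^ n) (exp ((G ^^ n) w)) = exp w"
    and "n > 0 \<Longrightarrow> (G ^^ n) w \<in> S"
proof -
  have 1: "(G ^^ n) w \<in> D" for n
    by (induction n) (use assms G(1) S_subset_strip strip_subset_D in auto)
  then show "(G ^^ n) w \<in> D" .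
  show "n > 0 \<Longrightarrow> (G ^^ n) w \<in> S"
    by (cases n) (use 1 G(1) in auto)
  show "(f ^^ n) (exp ((G ^^ n) w)) = exp w"
  proof (induction n)
    case (Suc n)
    have "f (exp (G ((G ^^ n) w))) = exp ((G ^^ n) w)"
      using exp_F[OF subsetD[OF S_subset_strip G(1)[OF 1]]] G(2)[OF 1] by simp
    then show ?case using Suc by (simp only: funpow.simps(2) o_apply funpow_swap1) 
  qed simp
qed

lemma G_iter_contract:
  assumes "v \<in> D" "w \<in> D"
  shows "norm ((G ^^ n) w - (G ^^ n) v) \<le> norm (w - v) / 2 ^ n"
proof (induction n)
  case (Suc n)
  have "norm ((G ^^ Suc n) w - (G ^^ Suc n) v) \<le> norm ((G ^^ n) w - (G ^^ n) v) / 2"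
    using G_contract[OF G_iter(1)[OF assms(1)] G_iter(1)[OF assms(2)]] by simp
  then show ?case using Suc by simp
qed auto

lemma continuous_on_G_iter: "continuous_on D (G ^^ n)"
proof (rule continuous_onI)
  fix e :: real and x :: complex assume "x \<in> D" "e > 0"
  then show "\<exists>d>0. \<forall>x'\<in>D. dist x' x < d \<longrightarrow> dist ((G ^^ n) x') ((G ^^ n) x) \<le> e"
  proof (intro exI[of _ e] conjI ballI impI)
    fix x' assume x': "x' \<in> D" "dist x' x < e"
    have "norm ((G ^^ n) x' - (G ^^ n) x) \<le> norm (x' - x) / 2 ^ n"
      by (rule G_iter_contract) (use \<open>x \<in> D\<close> x' in auto)
    also have "\<dots> \<le> norm (x' - x) / 1" by (intro divide_left_mono) auto
    finally show "dist ((G ^^ n) x') ((G ^^ n) x) \<le> e" using x' by (simp add: dist_norm)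
  qed auto
qed

lemma inj_on_G_iter: "inj_on (G ^^ n) D"
proof (induction n)
  case (Suc n)
  have "inj_on G D" using G(2) by (metis inj_onI)
  then have "inj_on (G \<circ> (G ^^ n)) D"
    using G_iter(1) by (intro comp_inj_on[OF Suc]) (auto intro: inj_on_subset)
  then show ?case by (simp only: funpow.simps(2))
qed (auto simp: inj_on_def)

text \<open>The lifted forward orbit of a positive point stays real, hence in \<open>S\<close>, so
  \<open>G\<close> retraces it step by step. This ties pulled back sets to a given positive point of
  \<open>U\<close>.\<close>

lemma real_orbit:
  assumes "x > 0"
  obtains \<xi> where "Im \<xi> = 0" "exp \<xi> = (f ^^ n) (of_real x)" "(G ^^ n) \<xi> = of_real (ln x)"
proof -
  have "\<exists>\<xi>. Im \<xi> = 0 \<and> exp \<xi> = (f ^^ n) (of_real x) \<and> (G ^^ n) \<xi> = of_real (ln x)"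
  proof (induction n)
    case 0
    show ?case using assms by (intro exI[of _ "of_real (ln x)"]) (simp add: exp_of_real)
  next
    case (Suc n)
    then obtain \<xi> where \<xi>: "Im \<xi> = 0" "exp \<xi> = (f ^^ n) (of_real x)" "(G ^^ n) \<xi> = of_real (ln x)" by blast
    have e: "\<xi> = of_real (Re \<xi>)" using \<xi>(1) by (simp add: complex_eq_iff)
    have "\<xi> \<in> S" using \<xi>(1) by (simp add: S_def)
    then have "(G ^^ Suc n) (F \<xi>) = of_real (ln x)" 
      using \<xi>(3) G_F by (simp only: funpow_Suc_right o_apply)
    moreover have "Im (F \<xi>) = 0" using F_of_real e by metis
    moreover have "exp (F \<xi>) = (f ^^ Suc n) (of_real x)"
      using exp_F[of \<xi>] \<open>\<xi> \<in> S\<close> S_subset_strip \<xi>(2) by auto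
    ultimately show ?case by blast
  qed
  then show thesis using that by blast
qed

text \<open>The recursion makes \<open>p (Suc i)\<close> the product for \<open>f (p i)\<close> cut
  after the factor \<open>i\<close>; the omitted tail lies between 1/2 and e. So the points
  \<open>ln (p i)\<close> form a pseudo-orbit of \<open>F\<close> with error 1.\<close>

lemma F_ln_p: 
  assumes "i \<ge> 1"
  shows "norm (F (of_real (ln (p i))) - of_real (ln (p (Suc i)))) \<le> 1"
proof -
  let ?v = "of_real (ln (p i)) :: complex"
  have "?v \<in> strip" by (simp add: strip_def)
  then have "norm (f (of_real (p i))) = exp (Re (F ?v))"
    using exp_F[of ?v] by (simp add: exp_of_real flip: norm_exp_eq_Re)
  then have Re: "Re (F ?v) = ln (norm (f (of_real (p i))))" by simp
  have q: "4 * p i \<le> p (Suc i)"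
  proof -
    have "(2::real) ^ 2 \<le> 2 ^ Suc i" using assms by (intro power_increasing) auto
    then have "2 ^ 2 * p i \<le> 2 ^ Suc i * p i" by (intro mult_right_mono) auto
    also have "\<dots> \<le> p (Suc i)" by (rule p_Suc_ge)
    finally show ?thesis by simp
  qed
  have q2: "2 * p i \<le> p (Suc i)" using q p_pos[of i] by linarith
  have q': "2 * p i / p (Suc i) \<le> 1/2" using q p_pos[of i] unfolding pos_divide_le_eq[OF p_pos] by linarith
  have "C * (norm (complex_of_real (p i)))^2 * (\<Prod>k<Suc i. norm (1 + of_real (p i) / complex_of_real (p k))) = p (Suc i)"
  proof -
    have "norm (1 + of_real (p i) / complex_of_real (p k)) = 1 + p i / p k" for k
    proof -
      have "1 + of_real (p i) / complex_of_real (p k) = of_real (1 + p i / p k)" by simp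
      then show ?thesis by (simp only: norm_of_real) (simp add: add_nonneg_nonneg)
    qed
    then show ?thesis unfolding rec[of i] lessThan_Suc_atMost by simp
  qed
  then have up: "norm (f (of_real (p i))) \<le> p (Suc i) * exp (2 * p i / p (Suc i))"
    and low: "norm (f (of_real (p i))) \<ge> p (Suc i) * (1 - 2 * p i / p (Suc i))"
    using f_bounds(1)[of "of_real (p i)" "Suc i"] f_bounds(2)[of "of_real (p i)" "Suc i"] q2
    by (simp_all only: norm_of_real abs_of_pos[OF p_pos])
  have "p (Suc i) * (1/2) \<le> p (Suc i) * (1 - 2 * p i / p (Suc i))" 
    using q' by (intro mult_left_mono) auto
  with low have low': "p (Suc i) / 2 \<le> norm (f (of_real (p i)))" by linarith
  have "p (Suc i) * exp (2 * p i / p (Suc i)) \<le> p (Suc i) * exp 1"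
  proof (rule mult_left_mono)
    show "exp (2 * p i / p (Suc i)) \<le> exp 1" using q' unfolding exp_le_cancel_iff by linarith
  qed simp
  with up have up': "norm (f (of_real (p i))) \<le> p (Suc i) * exp 1" by linarith
  have pos: "0 < norm (f (of_real (p i)))" using low' p_pos[of "Suc i"] by linarith
  have "ln (norm (f (of_real (p i)))) \<le> ln (p (Suc i) * exp 1)"
    using up' pos by (subst ln_le_cancel_iff) auto
  moreover have "ln (p (Suc i) / 2) \<le> ln (norm (f (of_real (p i))))"
    using low' pos by (subst ln_le_cancel_iff) auto
  moreover have "ln (2::real) \<le> 1" using ln_le_minus_one[of 2] by simp
  ultimately have "\<bar>Re (F ?v) - ln (p (Suc i))\<bar> \<le> 1"
    unfolding Re by (simp add: ln_mult ln_div)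
  moreover have "F ?v - of_real (ln (p (Suc i))) = of_real (Re (F ?v) - ln (p (Suc i)))"
    using F_of_real by (simp add: complex_eq_iff)
  ultimately show ?thesis by (simp only: norm_of_real)
qed

text \<open>Shadowing of the pseudo-orbit: the radius reproduces itself since (4 + 1) / 2 <= 4. It
  must exceed pi, the distance of the initial logarithm of \<open>- p m\<close> from
  \<open>ln (p m)\<close>.\<close>

lemma G_iter_near_ln_p:
  assumes "w \<in> D" "norm (w - of_real (ln (p (n + i)))) \<le> 4" "i \<ge> 1"
  shows "norm ((G ^^ n) w - of_real (ln (p i))) \<le> 4"
  using assms
proof (induction n arbitrary: w)
  case (Suc n)
  let ?v = "of_real (ln (p (n + i))) :: complex"
  have v: "?v \<in> S" by (simp add: S_def)
  then have Fv: "F ?v \<in> D"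
    using F_of_real[of "ln (p (n + i))"] by (simp add: D_def)
  have "norm (G w - ?v) = norm (G w - G (F ?v))" using G_F[OF v] by simp
  also have "\<dots> \<le> norm (w - F ?v) / 2" using Fv Suc.prems by (intro G_contract)
  also have "norm (w - F ?v) \<le> norm (w - of_real (ln (p (Suc (n + i))))) + norm (F ?v - of_real (ln (p (Suc (n + i)))))"
    by (rule order_trans[OF _ norm_triangle_ineq4]) simp
  also have "\<dots> \<le> 4 + 1" using Suc.prems F_ln_p[of "n + i"] by (intro add_mono) auto
  finally have "norm (G w - ?v) \<le> 4" by simp
  moreover have "G w \<in> D" using G(1)[OF Suc.prems(1)] S_subset_strip strip_subset_D by auto
  ultimately have "norm ((G ^^ n) (G w) - of_real (ln (p i))) \<le> 4"
    using Suc.prems by (intro Suc.IH) auto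
  then show ?case by (simp only: funpow_Suc_right o_apply)
qed simp

text \<open>By the chain rule this is the modulus of the derivative of the n-th iterate of
  \<open>F\<close> at \<open>(G ^^ n) w\<close>, the reciprocal of that of \<open>G ^^ n\<close> at
  \<open>w\<close>.\<close>

definition \<Lambda> :: "complex \<Rightarrow> nat \<Rightarrow> real" where
  "\<Lambda> w n = (\<Prod>i<n. norm (F' ((G ^^ Suc i) w)))"

lemma \<Lambda>_ge: 
  assumes "w \<in> D"
  shows "2 ^ n \<le> \<Lambda> w n"
proof -
  have "2 \<le> norm (F' ((G ^^ Suc i) w))" for i
  proof -
    have "(G ^^ Suc i) w \<in> strip" using G_iter(3)[OF assms, of "Suc i"] S_subset_strip by auto
    then show ?thesis using Re_F'_ge_2 complex_Re_le_cmod order_trans by blast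
  qed
  then have "(\<Prod>i<n. 2) \<le> \<Lambda> w n" unfolding \<Lambda>_def by (intro prod_mono) auto
  then show ?thesis by simp
qed

text \<open>The relative error made by linearising \<open>F\<close> at the \<open>j\<close>-th point of the backward orbit is at
  most \<open>3 t / 2^(j+1)\<close>, so the errors add up to a bounded factor.\<close>

lemma G_iter_distortion:
  assumes w: "w \<in> D" and \<tau>: "w + \<tau> \<in> D" "norm \<tau> \<le> 1/8"
  shows "norm \<tau> / 2 \<le> \<Lambda> w n * norm ((G ^^ n) (w + \<tau>) - (G ^^ n) w)"
    and "\<Lambda> w n * norm ((G ^^ n) (w + \<tau>) - (G ^^ n) w) \<le> 2 * norm \<tau>"
proof -
  define d where "d j = norm ((G ^^ j) (w + \<tau>) - (G ^^ j) w)" for j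
  define t where "t = norm \<tau>"
  have t: "0 \<le> t" "t \<le> 1/8" using \<tau> by (auto simp: t_def)
  \<comment> \<open>Both bounds equal \<open>t\<close> at j = 0 and tend to \<open>t / 2\<close> and
    \<open>2 * t\<close>. Their increments, of order 2^-j, leave room for the factors 1 + 3 q / 16
    and 1 - 3 q / 16 with q = 2^-j that one step costs.\<close>
  have "t * (1/2 + (1/2)^j / 2) \<le> \<Lambda> w j * d j \<and> \<Lambda> w j * d j \<le> t * (2 - (1/2)^j)" for j
  proof (induction j)
    case 0
    show ?case by (simp add: \<Lambda>_def d_def t_def)
  next
    case (Suc j)
    define q :: real where "q = (1/2)^j"
    define \<mu> where "\<mu> = norm (F' ((G ^^ Suc j) w))"
    define e where "e = \<Lambda> w (Suc j) * d (Suc j)"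
    have q: "0 < q" "q \<le> 1" unfolding q_def by (auto simp: power_le_one)
    have "d (Suc j) \<le> t / 2 ^ Suc j"
      unfolding d_def t_def using G_iter_contract[OF w \<tau>(1), of "Suc j"] by (simp del: funpow.simps)
    then have d1: "d (Suc j) \<le> t * q / 2" by (simp add: q_def power_divide)
    have "t * q \<le> 1/8 * 1" using t q by (intro mult_mono) auto
    then have d2: "d (Suc j) \<le> 1/4" using d1 by simp
    have "t * q \<le> 1/8 * q" using t q by (intro mult_right_mono) auto
    then have d3: "3 * d (Suc j) \<le> 3 * q / 16" using d1 by simp
    have FG: "F ((G ^^ Suc j) v) = (G ^^ j) v" if "v \<in> D" for v
      using G(2)[OF G_iter(1)[OF that]] by simp
    have ab: "\<bar>d j - \<mu> * d (Suc j)\<bar> \<le> 3 * d (Suc j) * (\<mu> * d (Suc j))"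
      using F_distortion[OF G_iter(3)[OF w, of "Suc j"] G_iter(3)[OF \<tau>(1), of "Suc j"]] d2
      unfolding FG[OF w] FG[OF \<tau>(1)] d_def \<mu>_def by simp
    have \<Lambda>: "\<Lambda> w j \<ge> 0" using \<Lambda>_ge[OF w, of j] by (rule order_trans[rotated]) simp
    have e: "e = \<Lambda> w j * (\<mu> * d (Suc j))" by (simp add: e_def \<Lambda>_def \<mu>_def)
    have e0: "e \<ge> 0" unfolding e using \<Lambda> by (simp add: \<mu>_def d_def)
    have "\<Lambda> w j * d j \<le> \<Lambda> w j * (\<mu> * d (Suc j) + 3 * d (Suc j) * (\<mu> * d (Suc j)))"
      using \<Lambda> ab by (intro mult_left_mono) auto
    also have "\<dots> = e + 3 * d (Suc j) * e" by (simp add: e algebra_simps)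
    also have "\<dots> \<le> e + 3 * q / 16 * e" using d3 e0 by (intro add_left_mono mult_right_mono)
    finally have 1: "\<Lambda> w j * d j \<le> e * (1 + 3 * q / 16)" by (simp add: algebra_simps)
    have "e - 3 * q / 16 * e \<le> e - 3 * d (Suc j) * e" using d3 e0 by (intro diff_left_mono mult_right_mono)
    also have "\<dots> = \<Lambda> w j * (\<mu> * d (Suc j) - 3 * d (Suc j) * (\<mu> * d (Suc j)))" 
      by (simp add: e algebra_simps)
    also have "\<dots> \<le> \<Lambda> w j * d j" using \<Lambda> ab by (intro mult_left_mono) auto
    finally have 2: "e * (1 - 3 * q / 16) \<le> \<Lambda> w j * d j" by (simp add: algebra_simps)
    have qq: "q * q \<le> q" using q mult_left_mono[of q 1 q] by simp
    have "t * (1/2 + q/4) * (1 + 3 * q / 16) \<le> t * (1/2 + q/2)"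
    proof -
      have "(1/2 + q/4) * (1 + 3 * q / 16) = 1/2 + 11/32 * q + 3/64 * (q * q)" by (simp add: field_simps)
      also have "\<dots> \<le> 1/2 + q/2" using qq q by linarith
      finally show ?thesis unfolding mult.assoc by (rule mult_left_mono) (rule t)
    qed
    also have "\<dots> \<le> e * (1 + 3 * q / 16)" using Suc 1 by (simp add: q_def)
    finally have lo: "t * (1/2 + q/4) \<le> e" using q by (auto dest: mult_right_le_imp_le)
    have "e * (1 - 3 * q / 16) \<le> t * (2 - q)" using Suc 2 by (simp add: q_def)
    also have "\<dots> \<le> t * (2 - q/2) * (1 - 3 * q / 16)"
    proof -
      have "2 - q \<le> 2 - 7/8 * q + 3/32 * (q * q)" using q zero_le_square[of q] by linarith
      also have "\<dots> = (2 - q/2) * (1 - 3 * q / 16)" by (simp add: field_simps)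
      finally show ?thesis unfolding mult.assoc by (rule mult_left_mono) (rule t)
    qed
    finally have hi: "e \<le> t * (2 - q/2)" using q by (auto dest: mult_right_le_imp_le)
    show ?case using lo hi by (simp add: e_def q_def)
  qed
  from this[of n] have *: "t * (1/2 + (1/2)^n / 2) \<le> \<Lambda> w n * d n" "\<Lambda> w n * d n \<le> t * (2 - (1/2)^n)" by auto
  have "t * (1/2) \<le> t * (1/2 + (1/2)^n / 2)" "t * (2 - (1/2)^n) \<le> t * 2"
    using t by (intro mult_left_mono; simp)+
  with * show "norm \<tau> / 2 \<le> \<Lambda> w n * norm ((G ^^ n) (w + \<tau>) - (G ^^ n) w)"
    "\<Lambda> w n * norm ((G ^^ n) (w + \<tau>) - (G ^^ n) w) \<le> 2 * norm \<tau>"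
    unfolding d_def t_def by linarith+
qed

section \<open>Joining the discs around zeros to the positive axis\<close>

definition \<omega> :: "nat \<Rightarrow> complex" where "\<omega> m = of_real (ln (p m)) + \<i> * of_real pi"

lemma exp_\<omega>: "exp (\<omega> m + \<tau>) = - of_real (p m) * exp \<tau>"
  by (simp add: \<omega>_def exp_add exp_of_real)

text \<open>A connected piece of logarithms joining a punctured disc around the zero \<open>- p m\<close> to the
  logarithms of \<open>L (m - 1)\<close>.\<close>

lemma bridge:
  fixes m :: nat
  defines "\<delta> \<equiv> 1 / (8 * (real m + 3))"
  defines "Box \<equiv> {w. ln (4 * p m) < Re w \<and> Re w < ln (p (Suc m) / 2) \<and> \<bar>Im w\<bar> < 3 * pi / 2}"
    and "Ann \<equiv> {w. 2 / 2 ^ Suc m < norm (w - \<omega> (Suc m)) \<and> norm (w - \<omega> (Suc m)) < \<delta> / 2}"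
  assumes m: "m \<ge> 10" and M: "M < ln (p m)"
  shows "\<exists>X. connected X \<and> Box \<union> Ann \<subseteq> X \<and> X \<subseteq> D \<and> (\<forall>w\<in>X. f (exp w) \<in> L (Suc m))"
proof -
  define m' where "m' = Suc m"
  define Seg where "Seg = (\<lambda>t. \<omega> m' - of_real t) ` {\<delta>/4..4/5}"
  define X where "X = Box \<union> Seg \<union> Ann"
  have \<delta>: "\<delta> > 0" "\<delta> \<le> 1/100" using m by (auto simp: \<delta>_def field_simps)
  \<comment> \<open>This puts the end \<open>t = \<delta>/4\<close> of the segment into
    \<open>Ann\<close> and keeps the segment outside the inner radius 1 / 2^m' around the
    zero.\<close>
  have two: "(1::real) / 2 ^ m' \<le> \<delta> / 8 * (1/2)"
  proof -
    have "256 * (real n + 3) \<le> 2 ^ n * 4" if "n \<ge> 10" for n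
      using that
    proof (induction n rule: nat_induct_at_least)
      case (Suc n)
      have "256 * (real (Suc n) + 3) = 256 * (real n + 3) + 256" by simp
      also have "\<dots> \<le> 2 ^ n * 4 + 2 ^ n * 4" 
        using Suc power_increasing[of 10 n "2::real"] by (intro add_mono) auto
      finally show ?case by simp
    qed simp
    from this[OF m] have "128 * (real m + 3) \<le> 2 ^ m'" by (simp add: m'_def)
    then show ?thesis by (simp add: \<delta>_def field_simps)
  qed
  have big: "1024 * p m \<le> p m'"
  proof -
    have "(2::real) ^ 10 \<le> 2 ^ m'" using m by (intro power_increasing) (auto simp: m'_def)
    then have "2 ^ 10 * p m \<le> 2 ^ m' * p m" by (intro mult_right_mono) auto
    also have "\<dots> \<le> p m'" unfolding m'_def by (rule p_Suc_ge)
    finally show ?thesis by simp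
  qed
  \<comment> \<open>The estimate near a zero is used with index m' = m + 1, which is why
    \<open>\<delta>\<close> contains m + 3.\<close>
  have e1: "1 + 1 / (8 * (real m' + 2)) = 1 + \<delta>" by (simp add: \<delta>_def m'_def)

  \<comment> \<open>The box is high enough to contain points with Im = 0 and with Im = pi: the
    passage from the positive to the negative axis takes place over \<open>L m\<close>.\<close>
  have Box: "f (exp w) \<in> L m'" "w \<in> D" if "w \<in> Box" for w
  proof -
    have "ln (4 * p m) \<ge> ln (p m)" by (subst ln_le_cancel_iff) auto
    then have "M < Re w \<and> \<bar>Im w\<bar> < 3 * pi / 2" using that M unfolding Box_def mem_Collect_eq by linarith
    then show "w \<in> D" by (simp add: D_def)
    have "exp (ln (4 * p m)) < exp (Re w)" "exp (Re w) < exp (ln (p m' / 2))"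
      using that unfolding exp_less_cancel_iff by (auto simp: Box_def m'_def)
    then have "exp w \<in> L m" by (simp add: L_def m'_def)
    then show "f (exp w) \<in> L m'" unfolding m'_def by (rule f_L)
  qed

  have near: "f (exp (\<omega> m' + \<tau>)) \<in> L m'" 
    if "norm (exp \<tau>) \<ge> 2/5" "norm (exp \<tau>) \<le> 1 + \<delta>" "norm (1 - exp \<tau>) \<ge> 1 / 2 ^ m'" "norm (1 - exp \<tau>) \<le> 3/5" for \<tau>
  proof -
    have n: "norm (- of_real (p m') * exp \<tau>) = p m' * norm (exp \<tau>)"
      by (simp only: norm_mult norm_minus_cancel norm_of_real) simp
    have d: "1 + - of_real (p m') * exp \<tau> / of_real (p m') = 1 - exp \<tau>" by simp
    show ?thesis unfolding exp_\<omega>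
    proof (rule f_near_zero)
      show "2 / 5 * p m' \<le> norm (- of_real (p m') * exp \<tau>)"
        unfolding n using that(1) by (subst mult.commute) (intro mult_left_mono, auto)
      show "norm (- of_real (p m') * exp \<tau>) \<le> (1 + 1 / (8 * (real m' + 2))) * p m'"
        unfolding n e1 using that(2) by (subst mult.commute) (intro mult_right_mono, auto)
      show "1 / 2 ^ m' \<le> norm (1 + - of_real (p m') * exp \<tau> / of_real (p m'))"
        unfolding d by (rule that(3))
      show "norm (1 + - of_real (p m') * exp \<tau> / of_real (p m')) \<le> 3/5"
        unfolding d by (rule that(4))
    qed (use m m'_def in auto)
  qed

  have inD: "\<omega> m' + \<tau> \<in> D" if "norm \<tau> \<le> 1" for \<tau>
  proof -
    have "\<bar>Re \<tau>\<bar> \<le> 1" "\<bar>Im \<tau>\<bar> \<le> 1" using that abs_Re_le_cmod[of \<tau>] abs_Im_le_cmod[of \<tau>] by linarith+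
    moreover have "M < ln (p m') - 1"
    proof -
      have "exp 1 \<le> (3::real)" using exp_bound[of 1] by simp
      then have "p m * exp 1 \<le> p m * 3" by (intro mult_left_mono) auto
      then have "p m * exp 1 \<le> p m'" using big p_pos[of m] by linarith
      then have "ln (p m * exp 1) \<le> ln (p m')" by (subst ln_le_cancel_iff) auto
      then show ?thesis using M by (simp add: ln_mult)
    qed
    ultimately show ?thesis using pi_gt3 by (simp add: D_def \<omega>_def) linarith
  qed

  have Seg: "f (exp w) \<in> L m'" "w \<in> D" if w: "w \<in> Seg" for w
  proof -
    obtain t where t': "\<delta>/4 \<le> t" "t \<le> 4/5" "w = \<omega> m' - of_real t" 
      using w by (auto simp: Seg_def)
    then have t: "\<delta>/4 \<le> t" "t \<le> 4/5" "w = \<omega> m' + of_real (- t)" by simp_all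
    have t0: "t > 0" using t \<delta> by linarith
    show "w \<in> D" unfolding t(3) using t t0 by (intro inD) (subst norm_of_real, simp)
    have et: "exp t \<le> 5/2"
    proof -
      have "exp t \<le> exp (4/5)" using t by simp
      also have "\<dots> \<le> 1 + 4/5 + (4/5)^2" by (intro exp_bound) auto
      also have "\<dots> \<le> 5/2" by (simp add: power2_eq_square)
      finally show ?thesis .
    qed
    have lo: "exp (- t) \<ge> 2/5" using et by (simp add: exp_minus field_simps)
    have up: "exp (- t) < 1" using t0 by simp
    have "1 - exp (- t) \<ge> \<delta> / 8"
    proof -
      have "1 + t \<le> exp t" by (rule exp_ge_add_one_self)
      then have "exp (-t) \<le> 1 / (1 + t)" using t0 by (simp add: exp_minus field_simps)
      also have "\<dots> \<le> 1 - t/2" using t0 t by (simp add: field_simps)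
      finally show ?thesis using t by linarith
    qed
    moreover have e: "exp (of_real (- t)) = complex_of_real (exp (- t))" by (rule exp_of_real)
    then have "1 - exp (complex_of_real (- t)) = of_real (1 - exp (- t))" by simp
    then have "norm (1 - exp (complex_of_real (- t))) = 1 - exp (- t)"
      using up by (simp only: norm_of_real)
    moreover have "norm (exp (complex_of_real (- t))) = exp (- t)"
      unfolding e norm_of_real by simp
    ultimately show "f (exp w) \<in> L m'" unfolding t(3)
      using lo up two \<delta> by (intro near) linarith+
  qed

  \<comment> \<open>In this range exp changes the distance to the centre by at most a factor 2
    either way; the radii 2 / 2^m' and \<open>\<delta> / 2\<close> allow for it.\<close>
  have Ann: "f (exp w) \<in> L m'" "w \<in> D" if "w \<in> Ann" for w
  proof -
    define \<tau> where "\<tau> = w - \<omega> m'"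
    have \<tau>: "2 / 2 ^ m' < norm \<tau>" "norm \<tau> < \<delta> / 2" "w = \<omega> m' + \<tau>" 
      using that by (auto simp: Ann_def \<tau>_def m'_def)
    have "norm \<tau> \<le> 1/4" using \<tau> \<delta> by linarith
    note b = norm_exp_minus_one_bounds[OF this]
    show "w \<in> D" unfolding \<tau>(3) using \<tau> \<delta> by (intro inD) auto
    have c: "norm (1 - exp \<tau>) = norm (exp \<tau> - 1)" by (rule norm_minus_commute)
    have "norm (exp \<tau>) \<le> 1 + norm (exp \<tau> - 1)" "1 - norm (exp \<tau> - 1) \<le> norm (exp \<tau>)"
      using norm_triangle_ineq[of 1 "exp \<tau> - 1"] norm_triangle_ineq[of "exp \<tau>" "1 - exp \<tau>"] c by auto
    moreover have "(2::real) / 2 ^ m' = 2 * (1 / 2 ^ m')" by simp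
    ultimately show "f (exp w) \<in> L m'" unfolding \<tau>(3)
      using b \<tau> \<delta> c by (intro near) linarith+
  qed

  have "connected X"
  proof -
    have "connected Box"
    proof -
      have "Box = ({w. Re w > ln (4 * p m)} \<inter> {w. Re w < ln (p (Suc m) / 2)}) \<inter> {w. \<bar>Im w\<bar> < 3 * pi / 2}"
        by (auto simp: Box_def)
      then show ?thesis
        by (simp only:) (intro convex_connected convex_Int convex_halfspace_Re_gt convex_halfspace_Re_lt convex_abs_Im_less)
    qed
    moreover have "connected Seg" unfolding Seg_def
      by (intro connected_continuous_image continuous_intros) auto
    moreover have "connected Ann" unfolding Ann_def by (rule connected_annulus) simp
    \<comment> \<open>Since 2 < exp(4/5) <= 5/2, the segment ends below \<open>p m' / 2\<close>,
      hence in the box, but stays above 2/5 of \<open>p m'\<close>.\<close>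
    moreover have "\<omega> m' - of_real (4/5) \<in> Box \<inter> Seg"
    proof
      show "\<omega> m' - of_real (4/5) \<in> Seg" unfolding Seg_def using \<delta> by (intro imageI) auto
      have "ln (4 * p m) < ln (p m') - 4/5"
      proof -
        have "exp (4/5) \<le> (3::real)" using exp_bound[of "4/5"] by (simp add: power2_eq_square)
        then have "4 * p m * exp (4/5) \<le> 4 * p m * 3" by (intro mult_left_mono) auto
        then have "4 * p m * exp (4/5) < p m'" using big p_pos[of m] by linarith
        then have "ln (4 * p m * exp (4/5)) < ln (p m')" by (subst ln_less_cancel_iff) auto
        then show ?thesis using ln_mult[of "4 * p m" "exp (4/5)"] by simp
      qed
      moreover have "ln (p m') - 4/5 < ln (p m' / 2)"
      proof -
        have "2 < exp (4/5 :: real)" using exp_lower_Taylor_quadratic[of "4/5::real"] by (simp add: power2_eq_square)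
        then have "ln 2 < ln (exp (4/5::real))" by (subst ln_less_cancel_iff) auto
        then show ?thesis by (simp add: ln_div)
      qed
      ultimately show "\<omega> m' - of_real (4/5) \<in> Box"
        by (simp add: Box_def \<omega>_def m'_def)
    qed
    moreover have "\<omega> m' - of_real (\<delta>/4) \<in> (Box \<union> Seg) \<inter> Ann"
    proof
      show "\<omega> m' - of_real (\<delta>/4) \<in> Box \<union> Seg" unfolding Seg_def using \<delta> by (intro UnI2 imageI) auto
      have "norm (complex_of_real (\<delta>/4)) = \<delta>/4" using \<delta> by (simp only: norm_of_real)
      then show "\<omega> m' - of_real (\<delta>/4) \<in> Ann" using two \<delta> by (simp add: Ann_def flip: m'_def)
    qed
    ultimately show ?thesis unfolding X_def by (metis connected_Un emptyE)
  qed
  then show ?thesis using Box Seg Ann 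
    by (intro exI[of _ X]) (auto simp: X_def m'_def)
qed

lemma disc_around_\<omega>_subset_D:
  assumes "M < ln (p m)" "norm (w - \<omega> (Suc m)) \<le> 1/8"
  shows "w \<in> D"
proof -
  have "ln (2 * p m) \<le> ln (p (Suc m))" using p_Suc_ge_2[of m] by (subst ln_le_cancel_iff) auto
  then have "ln 2 + ln (p m) \<le> ln (p (Suc m))" by (simp add: ln_mult)
  moreover have "\<bar>Re w - ln (p (Suc m))\<bar> \<le> 1/8" "\<bar>Im w - pi\<bar> \<le> 1/8"
    using assms(2) abs_Re_le_cmod[of "w - \<omega> (Suc m)"] abs_Im_le_cmod[of "w - \<omega> (Suc m)"]
    by (auto simp: \<omega>_def)
  ultimately have "M < Re w \<and> \<bar>Im w\<bar> < 3 * pi / 2"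
    using assms(1) ln2_ge_two_thirds pi_gt3 by linarith
  then show ?thesis by (simp add: D_def)
qed

text \<open>The level k is fixed and m = k + n varies, so \<open>\<alpha>\<close> stays bounded
  while \<open>\<Lambda>'\<close> grows like 2^n at least. The point \<open>x\<close> is the anchor
  that identifies the component containing the pulled back set.\<close>

lemma thin_annuli:
  assumes U: "U \<in> fatou_components f" and x: "of_real x \<in> U" "of_real x \<in> L k" "x > 0"
    and k: "k \<ge> 10" "M < ln (p k)" and \<eta>: "\<eta> > 0"
  shows "\<exists>\<alpha> \<rho> R e. 0 < \<rho> \<and> \<rho> < \<eta> * R \<and> R < \<eta> \<and> 0 < e \<and> 
     {z. \<rho> < norm (z - \<alpha>) \<and> norm (z - \<alpha>) < R} \<subseteq> U \<and> ball \<alpha> e \<inter> U = {}"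
proof -
  \<comment> \<open>The inequality \<open>\<rho> < \<eta> * R\<close> amounts to
    \<open>128 * s < \<eta> * \<delta>\<close>; inserting s = 2^-(m+1) and \<delta> = 1 / (8 (m +
    3)) gives 512 (m + 3) / 2^m < \<eta>.\<close>
  have "(\<lambda>m. 512 * (real m * (1/2)^m + 3 * (1/2)^m)) \<longlonglongrightarrow> 512 * (0 + 3 * 0)"
    using powser_times_n_limit_0[of "1/2::real"] by (intro tendsto_intros LIMSEQ_power_zero) auto
  then have "\<forall>\<^sub>F m in sequentially. 512 * (real m * (1/2)^m + 3 * (1/2)^m) < \<eta>"
    using \<eta> by (intro order_tendstoD(2)) auto
  then obtain N1 where N1: "\<And>m. m \<ge> N1 \<Longrightarrow> 512 * (real m * (1/2)^m + 3 * (1/2)^m) < \<eta>"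
    by (auto simp: eventually_sequentially)
  have "(\<lambda>n. (p (Suc k) * exp 4) * (1/2)^n) \<longlonglongrightarrow> (p (Suc k) * exp 4) * 0"
    by (intro tendsto_intros LIMSEQ_power_zero) auto
  then have "\<forall>\<^sub>F n in sequentially. (p (Suc k) * exp 4) * (1/2)^n < \<eta>"
    using \<eta> by (intro order_tendstoD(2)) auto
  then obtain N2 where N2: "\<And>n. n \<ge> N2 \<Longrightarrow> (p (Suc k) * exp 4) * (1/2)^n < \<eta>"
    by (auto simp: eventually_sequentially)
  define n where "n = max N1 N2"
  define m where "m = k + n"
  define \<delta> where "\<delta> = 1 / (8 * (real m + 3))"
  define s :: real where "s = 1 / 2 ^ Suc m"
  define w where "w = \<omega> (Suc m)"
  define a where "a = (G ^^ n) w"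
  define \<alpha> where "\<alpha> = exp a"
  define \<Lambda>' where "\<Lambda>' = \<Lambda> w n"
  \<comment> \<open>The annulus around \<open>w\<close> has radii \<open>2 * s\<close> and
    \<open>\<delta> / 2\<close>. The distortion of \<open>G ^^ n\<close> and that of exp cost a
    factor 2 each: this gives 8 inside, and outside 1/8 with a further factor 1/2 to spare.\<close>
  define \<rho> where "\<rho> = 8 * s * norm \<alpha> / \<Lambda>'"
  define R where "R = \<delta> * norm \<alpha> / (16 * \<Lambda>')"

  have m: "m \<ge> 10" "m \<ge> N1" using k by (auto simp: m_def n_def)
  have "ln (p k) \<le> ln (p m)" using p_mono[of k m] by (subst ln_le_cancel_iff) (auto simp: m_def)
  then have M: "M < ln (p m)" using k by linarith
  have \<delta>: "0 < \<delta>" "\<delta> \<le> 1/100" using m by (auto simp: \<delta>_def field_simps)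
  have s: "0 < s" by (simp add: s_def)
  have s\<delta>: "128 * s < \<eta> * \<delta>"
  proof -
    have "512 * (real m + 3) * (1/2)^m < \<eta>" using N1[OF m(2)] by (simp add: algebra_simps)
    then have "512 * (real m + 3) * (1/2)^m * \<delta> < \<eta> * \<delta>" using \<delta> by (intro mult_strict_right_mono)
    moreover have "512 * (real m + 3) * (1/2)^m * \<delta> = 128 * s"
    proof -
      have "\<delta> * (real m + 3) = 1/8" by (simp add: \<delta>_def)
      then have "512 * (\<delta> * (real m + 3)) * (1/2)^m = 128 * s" by (simp add: s_def power_divide)
      then show ?thesis by (simp only: mult_ac)
    qed
    ultimately show ?thesis by simp
  qed
  have disc: "v \<in> D" if "norm (v - w) \<le> 1/8" for v
    using disc_around_\<omega>_subset_D[OF M] that by (simp add: w_def)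
  have wD: "w \<in> D" by (rule disc) simp
  have \<Lambda>1: "2 ^ n \<le> \<Lambda>'" unfolding \<Lambda>'_def by (rule \<Lambda>_ge[OF wD])
  have \<Lambda>2: "1 \<le> \<Lambda>'" using \<Lambda>1 one_le_power[of "2::real" n] by linarith
  have \<alpha>0: "norm \<alpha> > 0" by (simp add: \<alpha>_def)
  have \<rho>0: "\<rho> > 0" using s \<alpha>0 \<Lambda>2 by (simp add: \<rho>_def)
  have \<rho>R: "\<rho> < \<eta> * R"
  proof -
    have "128 * s * (norm \<alpha> / (16 * \<Lambda>')) < \<eta> * \<delta> * (norm \<alpha> / (16 * \<Lambda>'))"
      using s\<delta> \<alpha>0 \<Lambda>2 by (intro mult_strict_right_mono) auto
    then show ?thesis by (simp add: \<rho>_def R_def)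
  qed
  have R: "R < \<eta>"
  proof -
    have "norm (a - of_real (ln (p (Suc k)))) \<le> 4"
      unfolding a_def
    proof (rule G_iter_near_ln_p[OF wD])
      show "norm (w - of_real (ln (p (n + Suc k)))) \<le> 4"
        using pi_less_4 by (simp add: w_def \<omega>_def m_def add.commute norm_mult)
    qed simp
    then have "Re a \<le> ln (p (Suc k)) + 4"
      using abs_Re_le_cmod[of "a - of_real (ln (p (Suc k)))"] by auto
    then have "exp (Re a) \<le> exp (ln (p (Suc k)) + 4)" by (subst exp_le_cancel_iff)
    then have "norm \<alpha> \<le> p (Suc k) * exp 4"
      by (simp add: \<alpha>_def exp_add)
    have "R = norm \<alpha> / \<Lambda>' * (\<delta> / 16)" by (simp add: R_def mult.commute)
    also have "\<dots> \<le> norm \<alpha> / \<Lambda>' * 1" using \<delta> \<alpha>0 \<Lambda>2 by (intro mult_left_mono) auto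
    also have "\<dots> \<le> (p (Suc k) * exp 4) / 2 ^ n" 
      using \<open>norm \<alpha> \<le> _\<close> \<Lambda>1 by (simp only: mult_1_right) (intro frac_le, auto)
    also have "\<dots> < \<eta>" using N2[of n] by (simp add: n_def power_divide)
    finally show ?thesis .
  qed

  obtain X where X: "connected X" "X \<subseteq> D" "\<And>v. v \<in> X \<Longrightarrow> f (exp v) \<in> L (Suc m)"
    and box: "{v. ln (4 * p m) < Re v \<and> Re v < ln (p (Suc m) / 2) \<and> \<bar>Im v\<bar> < 3 * pi / 2} \<subseteq> X"
    and ann: "{v. 2 / 2 ^ Suc m < norm (v - \<omega> (Suc m)) \<and> norm (v - \<omega> (Suc m)) < 1 / (8 * (real m + 3)) / 2} \<subseteq> X"
    using bridge[OF m(1) M] by blast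

  define W where "W = (\<lambda>v. exp ((G ^^ n) v)) ` X"
  have "W \<subseteq> U"
  proof -
    let ?O = "(f ^^ Suc n) -` L (Suc m)"
    have "open (L (Suc m))" unfolding L_def
      by (intro open_Collect_conj open_Collect_less continuous_intros)
    then have "open ?O" using continuous_on_f_iter by (intro open_vimage)
    then have "?O \<subseteq> fatou_set f" by (rule fatou_set_if_iterate_into_L[of _ "Suc n"]) simp
    moreover have "W \<subseteq> ?O"
    proof -
      have "(f ^^ Suc n) (exp ((G ^^ n) v)) \<in> L (Suc m)" if "v \<in> X" for v
        using G_iter(2)[of v n] X(3)[OF that] X(2) that by auto
      then show ?thesis by (auto simp: W_def)
    qed
    moreover have "connected W" unfolding W_def
      by (intro connected_continuous_image continuous_on_exp continuous_on_subset[OF continuous_on_G_iter] X)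
    \<comment> \<open>The n-th image of \<open>x\<close> is a positive point of \<open>L m\<close>,
      so its real logarithm lies in the box, and \<open>G ^^ n\<close> takes it back to
      \<open>ln x\<close>.\<close>
    moreover have "of_real x \<in> W"
    proof -
      obtain \<xi> where \<xi>: "Im \<xi> = 0" "exp \<xi> = (f ^^ n) (of_real x)" "(G ^^ n) \<xi> = of_real (ln x)"
        using real_orbit[OF x(3)] .
      have "exp \<xi> \<in> L m" unfolding \<xi>(2) m_def by (intro f_iter_L x)
      then have e: "4 * p m < exp (Re \<xi>)" "exp (Re \<xi>) < p (Suc m) / 2" by (auto simp: L_def)
      then have "ln (4 * p m) < ln (exp (Re \<xi>))" "ln (exp (Re \<xi>)) < ln (p (Suc m) / 2)"
        by (subst ln_less_cancel_iff; simp)+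
      then have "\<xi> \<in> X" using \<xi>(1) by (intro subsetD[OF box]) simp
      moreover have "of_real x = exp ((G ^^ n) \<xi>)" unfolding \<xi>(3) using x(3) by (simp add: exp_of_real)
      ultimately show ?thesis unfolding W_def by (rule rev_image_eqI)
    qed
    ultimately show ?thesis using U x(1) unfolding fatou_components_def
      by (intro components_maximal[of U "fatou_set f"]) auto
  qed
  moreover have "{z. \<rho> < norm (z - \<alpha>) \<and> norm (z - \<alpha>) < R} \<subseteq> W"
  proof
    fix z assume "z \<in> {z. \<rho> < norm (z - \<alpha>) \<and> norm (z - \<alpha>) < R}"
    then have z: "\<rho> < norm (z - \<alpha>)" "norm (z - \<alpha>) < R" by auto
    define u where "u = z / \<alpha> - 1"
    have "\<alpha> \<noteq> 0" by (simp add: \<alpha>_def)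
    then have "z - \<alpha> = u * \<alpha>" by (simp add: u_def field_simps)
    then have zu: "norm (z - \<alpha>) = norm u * norm \<alpha>" by (simp add: norm_mult)
    have "8 * s / \<Lambda>' * norm \<alpha> < norm u * norm \<alpha>" "norm u * norm \<alpha> < \<delta> / (16 * \<Lambda>') * norm \<alpha>"
      using z unfolding zu \<rho>_def R_def by simp_all
    then have u: "8 * s / \<Lambda>' < norm u" "norm u < \<delta> / (16 * \<Lambda>')"
      unfolding mult_less_cancel_right_pos[OF \<alpha>0] .
    have "\<delta> / (16 * \<Lambda>') \<le> \<delta> / 16" using \<delta> \<Lambda>2 by (intro divide_left_mono) auto
    then have u2: "norm u < 1/8" using u \<delta> by linarith
    define \<beta> where "\<beta> = Ln (1 + u)"
    have \<beta>1: "norm \<beta> \<le> 2 * norm u" unfolding \<beta>_def using u2 by (intro norm_Ln_le) auto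
    have "1 + u \<noteq> 0"
    proof
      assume "1 + u = 0"
      then have "u = -1" by (simp add: eq_neg_iff_add_eq_0 add.commute)
      then show False using u2 by simp
    qed
    then have e\<beta>: "exp \<beta> = 1 + u" by (simp add: \<beta>_def)
    have \<beta>2: "norm u \<le> 2 * norm \<beta>"
      using norm_exp_minus_one_bounds(1)[of \<beta>] \<beta>1 u2 unfolding e\<beta> by simp
    have "\<delta> / (8 * \<Lambda>') < \<delta> / (4 * \<Lambda>')" using \<delta> \<Lambda>2 by (intro divide_strict_left_mono) auto
    then have \<beta>3: "norm \<beta> < \<delta> / (4 * \<Lambda>')" using \<beta>1 u by simp
    have dist: "norm \<tau> / 2 \<le> \<Lambda>' * norm ((G ^^ n) (w + \<tau>) - a)"
      "\<Lambda>' * norm ((G ^^ n) (w + \<tau>) - a) \<le> 2 * norm \<tau>" if "norm \<tau> \<le> \<delta> / 2" for \<tau>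
      unfolding \<Lambda>'_def a_def using that \<delta> by (intro G_iter_distortion wD disc; simp)+
    \<comment> \<open>Surjectivity: \<open>G ^^ n\<close> is open on the disc, and by the lower
      distortion bound it keeps the boundary circle at distance at least
      \<open>\<delta> / (4 * \<Lambda>')\<close> from \<open>a\<close>.\<close>
    have "ball ((G ^^ n) w) (\<delta> / (4 * \<Lambda>')) \<subseteq> (G ^^ n) ` ball w (\<delta> / 2)"
    proof (rule ball_subset_open_map_image)
      have sub: "cball w (\<delta> / 2) \<subseteq> D" using \<delta> by (auto simp: dist_norm norm_minus_commute intro!: disc)
      then show "continuous_on (closure (ball w (\<delta> / 2))) (G ^^ n)"
        using \<delta> by (intro continuous_on_subset[OF continuous_on_G_iter]) auto
      have sub': "ball w (\<delta> / 2) \<subseteq> D" using sub by auto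
      show "open ((G ^^ n) ` interior (ball w (\<delta> / 2)))"
        using sub' by (simp only: interior_open[OF open_ball])
           (intro invariance_of_domain open_ball continuous_on_subset[OF continuous_on_G_iter] inj_on_subset[OF inj_on_G_iter])
      fix v assume "v \<in> frontier (ball w (\<delta> / 2))"
      then have v: "norm (v - w) = \<delta> / 2" using \<delta> by (simp add: dist_norm norm_minus_commute)
      then have "\<delta> / 4 \<le> \<Lambda>' * norm ((G ^^ n) v - a)" using dist(1)[of "v - w"] by simp
      then show "\<delta> / (4 * \<Lambda>') \<le> norm ((G ^^ n) v - (G ^^ n) w)" 
        using \<Lambda>2 by (simp add: a_def field_simps)
    qed (use \<delta> \<Lambda>2 in auto)
    moreover have "a + \<beta> \<in> ball ((G ^^ n) w) (\<delta> / (4 * \<Lambda>'))" using \<beta>3 by (simp add: a_def dist_norm)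
    ultimately obtain v where v: "v \<in> ball w (\<delta> / 2)" "a + \<beta> = (G ^^ n) v" by blast
    have vw: "norm (v - w) < \<delta> / 2" using v(1) by (simp add: dist_norm norm_minus_commute)
    have "\<Lambda>' * norm \<beta> \<le> 2 * norm (v - w)"
      using dist(2)[of "v - w"] vw v(2)[symmetric] by simp
    moreover have "8 * s < \<Lambda>' * norm u" using u \<Lambda>2 by (simp add: field_simps)
    moreover have "\<Lambda>' * norm u \<le> \<Lambda>' * (2 * norm \<beta>)" using \<beta>2 \<Lambda>2 by (intro mult_left_mono) auto
    ultimately have "2 * s < norm (v - w)" by linarith
    then have "v \<in> X" using vw by (intro subsetD[OF ann]) (simp add: s_def \<delta>_def w_def)
    moreover have "z = exp ((G ^^ n) v)"
      unfolding v(2)[symmetric] exp_add e\<beta> using \<open>\<alpha> \<noteq> 0\<close> by (simp add: u_def \<alpha>_def)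
    ultimately show "z \<in> W" unfolding W_def by blast
  qed
  moreover obtain e where "e > 0" "ball \<alpha> e \<inter> U = {}"
  proof -
    have "(f ^^ n) \<alpha> = - of_real (p (Suc m))"
      using G_iter(2)[OF wD, of n] exp_\<omega>[of "Suc m" 0] by (simp add: \<alpha>_def a_def w_def)
    then have "(f ^^ Suc n) \<alpha> = 0" using f_neg_p by simp
    then obtain e where 
      "e > 0" "\<And>z. z \<in> ball \<alpha> e \<Longrightarrow> \<not> filterlim (\<lambda>n. (f ^^ n) z) at_infinity sequentially"
      by (rule not_escaping_near_preimage_of_0) blast
    moreover have "filterlim (\<lambda>n. (f ^^ n) z) at_infinity sequentially" if "z \<in> U" for z
      by (rule escaping_in_fatou_component[OF U x(1) that L_escaping[OF x(2)]])
    ultimately have "ball \<alpha> e \<inter> U = {}" by blast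
    with \<open>e > 0\<close> show thesis by (rule that)
  qed
  ultimately show ?thesis using \<rho>0 \<rho>R R by blast
qed

text \<open>Three factors of the product already give a constant times \<open>(p k)^5\<close>. The
  inequality makes the annulus of the claim nonempty.\<close>

lemma p_Suc_gt_power_4: "\<forall>\<^sub>F k in sequentially. (p k)^4 < p (Suc k)"
proof -
  have "\<forall>\<^sub>F k in sequentially. p 0 * p 1 * p 2 / C < p k"
    using p_at_top by (simp add: filterlim_at_top_dense)
  then show ?thesis using eventually_ge_at_top[of 3]
  proof eventually_elim
    case (elim k)
    have "p k / p 0 * (p k / p 1) * (p k / p 2) = (\<Prod>j<3. p k / p j)"
      by (simp add: numeral_eq_Suc)
    also have "\<dots> \<le> (\<Prod>j<3. 1 + p k / p j)" by (intro prod_mono) auto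
    also have "\<dots> \<le> (\<Prod>j<k. 1 + p k / p j)"
      using elim by (intro prod_mono2) (auto simp: add_nonneg_nonneg)
    finally have P: "p k / p 0 * (p k / p 1) * (p k / p 2) \<le> (\<Prod>j<k. 1 + p k / p j)" .
    have "(p k)^4 = (p k)^2 * (p k * p k)" by (simp add: power4_eq_xxxx power2_eq_square)
    also have "\<dots> < (p k)^2 * (C * (p k / p 0 * (p k / p 1) * (p k / p 2)))"
    proof (rule mult_strict_left_mono)
      have "p 0 * p 1 * p 2 < C * p k" using elim(1) Cpos by (simp add: field_simps)
      then have "p k * p k * (p 0 * p 1 * p 2) < p k * p k * (C * p k)" by (intro mult_strict_left_mono) auto
      then show "p k * p k < C * (p k / p 0 * (p k / p 1) * (p k / p 2))"
        by (simp add: field_simps)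
    qed simp
    also have "\<dots> \<le> (p k)^2 * (C * (\<Prod>j<k. 1 + p k / p j))"
      using P Cpos by (intro mult_left_mono) auto
    also have "\<dots> \<le> 2 * ((p k)^2 * (C * (\<Prod>j<k. 1 + p k / p j)))"
      using Cpos by (auto intro!: mult_nonneg_nonneg prod_nonneg add_nonneg_nonneg)
    also have "\<dots> = p (Suc k)" unfolding p_Suc_eq[of k] by simp
    finally show ?case .
  qed
qed

lemma eventually_infinitely_connected_not_uniformly_perfect:
  "\<forall>\<^sub>F k in sequentially. \<forall>U. U \<in> fatou_components f \<and>
     {z. (p k)^2 < norm z \<and> norm z < sqrt (p (Suc k))} \<subseteq> U \<longrightarrow>
     infinitely_connected U \<and> \<not> uniformly_perfect (frontier U)"
proof -
  have "\<forall>\<^sub>F k in sequentially. exp M < p k" 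
    using p_at_top by (simp add: filterlim_at_top_dense)
  then show ?thesis using p_Suc_gt_power_4 eventually_ge_at_top[of 10]
  proof eventually_elim
    case (elim k)
    have "(2::real)^2 \<le> 2 ^ k" using elim(3) by (intro power_increasing) auto
    then have pk: "4 \<le> p k" using p_ge_two_pow[of k] by simp
    then have pk': "4 \<le> p (Suc k)" using p_mono[of k "Suc k"] by simp
    have "ln (exp M) < ln (p k)" using elim(1) by (subst ln_less_cancel_iff) auto
    then have M: "M < ln (p k)" by simp
    \<comment> \<open>A positive point in both the annulus of the claim, hence in \<open>U\<close>,
      and \<open>L k\<close>.\<close>
    define x where "x = ((p k)^2 + sqrt (p (Suc k))) / 2"
    have "((p k)^2)^2 < p (Suc k)" using elim(2) by simp
    then have "(p k)^2 < sqrt (p (Suc k))" by (rule real_less_rsqrt)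
    then have x: "(p k)^2 < x" "x < sqrt (p (Suc k))" by (auto simp: x_def)
    have "4 * p k \<le> p k * p k" using pk by (intro mult_right_mono) auto
    then have x1: "4 * p k < x" using x(1) unfolding power2_eq_square by linarith
    have x0: "x > 0" using x1 p_pos[of k] by linarith
    have "2 * sqrt (p (Suc k)) \<le> sqrt (p (Suc k)) * sqrt (p (Suc k))"
      using real_sqrt_le_mono[OF pk'] by (intro mult_right_mono) auto
    then have x2: "x < p (Suc k) / 2" using x(2) by simp
    show ?case
    proof (intro allI impI)
      fix U assume U: "U \<in> fatou_components f \<and>
        {z. (p k)^2 < norm z \<and> norm z < sqrt (p (Suc k))} \<subseteq> U"
      have "of_real x \<in> U" using U x x0 by auto
      moreover have "complex_of_real x \<in> L k" using x0 x1 x2 by (simp add: L_def)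
      ultimately have "\<exists>\<alpha> \<rho> R e. 0 < \<rho> \<and> \<rho> < \<eta> * R \<and> R < \<eta> \<and> 0 < e \<and> 
         {z. \<rho> < norm (z - \<alpha>) \<and> norm (z - \<alpha>) < R} \<subseteq> U \<and> ball \<alpha> e \<inter> U = {}" if "\<eta> > 0" for \<eta>
        using U x0 elim(3) M that by (intro thin_annuli[of U x k]) auto
      then show "infinitely_connected U \<and> \<not> uniformly_perfect (frontier U)"
        using infinitely_connected_if_thin_annuli[of U] not_uniformly_perfect_if_thin_annuli[of U] by blast
    qed
  qed
qed

end

theorem mainTheorem4:
  fixes C :: real and r :: "nat \<Rightarrow> real" and f :: "complex \<Rightarrow> complex"
  assumes "r 1 > 1" and "C > 0"
    and "C * exp (2 / r 1) < 1 / 4" and "C * r 1 > 1"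
    and "\<And>k. k \<ge> 1 \<Longrightarrow> r (k + 1) = C * (r k)^2 * (\<Prod>j=1..k. (1 + r k / r j))"
    and "\<And>z. f z = complex_of_real C * z^2 * (\<Prod>k. (1 + z / complex_of_real (r (k + 1))))"
  shows "\<forall>\<^sub>F k in sequentially. \<forall>U.
           U \<in> fatou_components f \<and> multiply_connected U \<and> wandering_domain f U \<and>
           {z. (r k)^2 < norm z \<and> norm z < sqrt (r (k + 1))} \<subseteq> U \<longrightarrow>
           infinitely_connected U \<and> \<not> uniformly_perfect (frontier U)"
proof -
  define p where "p k = r (Suc k)" for k
  interpret baker C p f
  proof
    show "p (Suc k) = C * (p k)^2 * (\<Prod>j\<le>k. (1 + p k / p j))" for k
    proof -
      have "(\<Prod>j=1..Suc k. (1 + r (Suc k) / r j)) = (\<Prod>j\<le>k. (1 + p k / p j))"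
        unfolding p_def by (rule prod.reindex_bij_witness[of _ Suc "\<lambda>j. j - 1"]) auto
      then show ?thesis using assms(5)[of "Suc k"] by (simp add: p_def)
    qed
  qed (use assms in \<open>auto simp: p_def\<close>)
  obtain N where N: "\<And>k U. k \<ge> N \<Longrightarrow> U \<in> fatou_components f \<Longrightarrow>
      {z. (p k)^2 < norm z \<and> norm z < sqrt (p (Suc k))} \<subseteq> U \<Longrightarrow>
      infinitely_connected U \<and> \<not> uniformly_perfect (frontier U)"
    using eventually_infinitely_connected_not_uniformly_perfect unfolding eventually_sequentially by blast
  show ?thesis
    unfolding eventually_sequentially
  \<comment> \<open>The shift by one accounts for \<open>r k = p (k - 1)\<close>, which holds for
    \<open>k \<ge> 1\<close>.\<close>
  proof (intro exI[of _ "Suc N"] allI impI)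
    fix k U assume k: "Suc N \<le> k" and U: "U \<in> fatou_components f \<and> multiply_connected U \<and> wandering_domain f U \<and>
           {z. (r k)^2 < norm z \<and> norm z < sqrt (r (k + 1))} \<subseteq> U"
    then show "infinitely_connected U \<and> \<not> uniformly_perfect (frontier U)"
      by (intro N[of "k - 1"]) (auto simp: p_def Suc_diff_Suc)
  qed
qed

end
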